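(* Fix $0<q<1$ and let $\Pi_n \sim \mathrm{Mallows}(n,q)$. There exist positive constants $m_1,m_2,\ldots$ and an infinite matrix $P\in \mathbb{R}^{\mathbb{N}\times\mathbb{N}}$ such that for all $\ell\ge 1$, $$\frac{1}{\sqrt{n}}\bigl(C_1(\Pi_n)-m_1 n,\ \ldots,\ C_\ell(\Pi_n)-m_\ell n\bigr)\ \xrightarrow[n\to\infty]{d}\ \mathcal{N}_\ell(\vec 0, P_\ell),$$ where $\mathcal{N}_\ell(\cdot,\cdot)$ denotes the $\ell$-dimensional multivariate normal distribution and $P_\ell$ is the submatrix of $P$ on the indices $[\ell]\times[\ell]$.
   Context: For $n\in\mathbb{N}$, $S_n$ is the set of permutations of $[n]=\{1,\dots,n\}$. For $\pi\in S_n$, a pair $(i,j)$ with $i<j$ and $\pi(i)>\pi(j)$ is an inversion; $\mathrm{inv}(\pi)$ is the number of inversions. For $q>0$, $\Pi_n\sim\mathrm{Mallows}(n,q)$ means $\mathbb{P}(\Pi_n=\pi)=q^{\mathrm{inv}(\pi)}/\sum_{\sigma\in S_n}q^{\mathrm{inv}(\sigma)}$ for every $\pi\in S_n$. For a permutation $\pi$, $C_i(\pi)$ denotes the number of cycles of length $i$ of $\pi$. *)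

theory Defs
  imports "HOL-Probability.Probability" "HOL-Combinatorics.Combinatorics"
begin

definition perms :: "nat \<Rightarrow> (nat \<Rightarrow> nat) set" where
  "perms n = {\<pi>. \<pi> permutes {1..n}}"

definition inv_count :: "nat \<Rightarrow> (nat \<Rightarrow> nat) \<Rightarrow> nat" where
  "inv_count n \<pi> = card {(i, j). i \<in> {1..n} \<and> j \<in> {1..n} \<and> i < j \<and> \<pi> i > \<pi> j}"

definition mallows_prob :: "nat \<Rightarrow> real \<Rightarrow> (nat \<Rightarrow> nat) \<Rightarrow> real" where
  "mallows_prob n q \<pi> = q ^ inv_count n \<pi> / (\<Sum>\<sigma>\<in>perms n. q ^ inv_count n \<sigma>)"

definition mallows_expect :: "nat \<Rightarrow> real \<Rightarrow> ((nat \<Rightarrow> nat) \<Rightarrow> real) \<Rightarrow> real" where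
  "mallows_expect n q g = (\<Sum>\<pi>\<in>perms n. mallows_prob n q \<pi> * g \<pi>)"

definition cycle_count :: "nat \<Rightarrow> nat \<Rightarrow> (nat \<Rightarrow> nat) \<Rightarrow> nat" where
  "cycle_count n i \<pi> = card {orbit \<pi> x | x. x \<in> {1..n} \<and> card (orbit \<pi> x) = i}"

text \<open>Vectors in R^l are represented as functions nat => real, indexed by {1..l}
  and zero outside. A centred l-dimensional normal vector with covariance
  Sigma (restricted to {1..l} x {1..l}) is represented as A G, where
  A A^T = Sigma and G is a vector of l i.i.d. standard normals.\<close>
definition std_gauss_vec :: "nat \<Rightarrow> (nat \<Rightarrow> real) measure" where
  "std_gauss_vec l = PiM {1..l} (\<lambda>_. density lborel std_normal_density)"

definition lin_map :: "nat \<Rightarrow> (nat \<Rightarrow> nat \<Rightarrow> real) \<Rightarrow> (nat \<Rightarrow> real) \<Rightarrow> (nat \<Rightarrow> real)" where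
  "lin_map l A g = (\<lambda>i. if i \<in> {1..l} then (\<Sum>k\<in>{1..l}. A i k * g k) else 0)"

text \<open>Convergence in distribution of random vectors X_n (given through their
  expectation functionals E_n) to N_l(0, Sigma_l): E_n f -> E f(Z) for every
  bounded continuous f on R^l.\<close>
definition conv_dist_normal ::
  "nat \<Rightarrow> (nat \<Rightarrow> ((nat \<Rightarrow> real) \<Rightarrow> real) \<Rightarrow> real) \<Rightarrow> (nat \<Rightarrow> nat \<Rightarrow> real) \<Rightarrow> bool" where
  "conv_dist_normal l E \<Sigma> \<longleftrightarrow>
     (\<exists>A :: nat \<Rightarrow> nat \<Rightarrow> real.
        (\<forall>i\<in>{1..l}. \<forall>j\<in>{1..l}. \<Sigma> i j = (\<Sum>k\<in>{1..l}. A i k * A j k)) \<and>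
        (\<forall>f :: (nat \<Rightarrow> real) \<Rightarrow> real. continuous_on UNIV f \<longrightarrow> bounded (range f) \<longrightarrow>
           (\<lambda>n. E n f) \<longlonglongrightarrow> (\<integral>g. f (lin_map l A g) \<partial>std_gauss_vec l)))"

definition cycle_vec :: "nat \<Rightarrow> (nat \<Rightarrow> real) \<Rightarrow> nat \<Rightarrow> (nat \<Rightarrow> nat) \<Rightarrow> (nat \<Rightarrow> real)" where
  "cycle_vec l m n \<pi> =
     (\<lambda>i. if i \<in> {1..l} then (real (cycle_count n i \<pi>) - m i * real n) / sqrt (real n) else 0)"

end

theory Submission
  imports Defs "HOL-Real_Asymp.Real_Asymp"
begin

text \<open>
  Every permutation is uniquely a direct sum of an indecomposable permutation and a remainder;
  inversions and cycle counts are additive along direct sums, so the weighted sums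
  \<open>v s n = (1 - q)^n * (\<Sum>\<pi>. q^inv \<pi> * cis (s * Y \<pi>))\<close> of a linear combination \<open>Y\<close> of the centred
  cycle counts satisfy a renewal equation whose kernel is a sum over indecomposable blocks. For
  \<open>s = 0\<close> the solution is \<open>u n = (\<Prod>k=1..n. 1 - q^k)\<close>, which converges exponentially fast to a positive
  limit \<open>c\<close>; this makes the block length exponentially integrable. With mean zero blocks and
  \<open>V = E Y\<^sup>2 / E k\<close>, the tilted sequence \<open>w n = v s n * exp (V s\<^sup>2 n / 2)\<close> solves a renewal equation
  whose kernel differs from that of \<open>u\<close> by terms of sum \<open>O(s\<^sup>3)\<close>; comparing resolvents gives
  \<open>w n - u n = O(1 / sqrt n)\<close> at \<open>s = 1 / sqrt n\<close>, that is \<open>v (1 / sqrt n) n \<longlonglongrightarrow> c * exp (- V / 2)\<close>.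
  A finite-dimensional Levy continuity theorem turns this into convergence in distribution.
\<close>

section \<open>Perturbed renewal equations\<close>

text \<open>The obstacle is that \<open>u\<close> tends to a positive limit, so convolution with it
  damps nothing: single terms of the kernel difference are only of order s, while about 1 / s^2
  indices have to be summed. Splitting \<open>u = c + (u - c)\<close> isolates the part that does
  not decay, and there the convolution becomes \<open>c\<close> times partial sums of the kernel
  difference. In these the terms of order s and s^2 cancel over all block lengths together, because
  the marks have mean zero and the tilt matches the variance per unit length. So a partial sum is
  minus a tail, and tails are summable at the price of one more moment. What remains is cubic in s
  at each index, hence again of order s after 1 / s^2 indices. The argument needs third moments of
  the block length; exponential tails supply them.

  The power (1 - q)^n is the geometric factor under which the q-factorial has a finite positive
  limit. Dividing \<open>v\<close> by \<open>u\<close> conditions a renewal process on having a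
  renewal at n, and \<open>c\<close> cancels in the ratio.\<close>

lemma renewal_perturbation:
  fixes u w p g :: "nat \<Rightarrow> complex"
  assumes u: "\<And>n. u n = (if n = 0 then 1 else 0) + (\<Sum>k\<le>n. p k * u (n - k))"
    and w: "\<And>n. w n = (if n = 0 then 1 else 0) + (\<Sum>k\<le>n. g k * w (n - k))"
  shows "w n = u n + (\<Sum>j\<le>n. (\<Sum>k\<le>j. (g k - p k) * u (j - k)) * w (n - j))"
proof -
  define U W P G where "U = Abs_fps u" and "W = Abs_fps w" and "P = Abs_fps p" and "G = Abs_fps g"
  have U: "U = 1 + P * U"
    by (rule fps_ext, subst U_def, subst fps_nth_Abs_fps, subst u)
       (simp add: fps_mult_nth P_def U_def atLeast0AtMost)
  have W: "W = 1 + G * W"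
    by (rule fps_ext, subst W_def, subst fps_nth_Abs_fps, subst w)
       (simp add: fps_mult_nth G_def W_def atLeast0AtMost)
  \<comment> \<open>Resolvent identity: \<open>U\<close> and \<open>W\<close> are the inverses of 1
    - P and 1 - G, so W - U = U (G - P) W.\<close>
  have "(G - P) * U * W = U * (G * W) - (P * U) * W"
    by (simp add: algebra_simps)
  also have "G * W = W - 1" using W by (simp add: algebra_simps)
  also have "P * U = U - 1" using U by (simp add: algebra_simps)
  finally have "W = U + (G - P) * U * W"
    by (simp add: algebra_simps)
  then have "fps_nth W n = fps_nth (U + (G - P) * U * W) n" by simp
  then show ?thesis
    by (simp add: W_def U_def G_def P_def fps_mult_nth atLeast0AtMost)
qed

text \<open>A bootstrap: the maximum \<open>M\<close> of the norms of \<open>w\<close> over {..N} is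
  finite in any case, and the recursion gives M \<le> 1 + \<epsilon> M, hence M \<le> 2. Reinserting
  this bound controls the difference.\<close>

lemma renewal_stability:
  fixes u w h :: "nat \<Rightarrow> complex"
  assumes w: "\<And>n. w n = u n + (\<Sum>j\<le>n. h j * w (n - j))"
    and u: "\<And>n. norm (u n) \<le> 1"
    and h: "(\<Sum>j\<le>N. norm (h j)) \<le> \<epsilon>" and \<epsilon>: "\<epsilon> \<le> 1/2"
  shows "norm (w N - u N) \<le> 2 * \<epsilon>"
proof -
  define M where "M = Max ((\<lambda>n. norm (w n)) ` {..N})"
  have M: "norm (w n) \<le> M" if "n \<le> N" for n
    unfolding M_def using that by (intro Max_ge) auto
  have "M \<ge> 0" using M[of N] norm_ge_zero order_trans by blast
  have diff: "norm (w n - u n) \<le> \<epsilon> * M" if n: "n \<le> N" for n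
  proof -
    have "norm (w n - u n) \<le> (\<Sum>j\<le>n. norm (h j) * norm (w (n - j)))"
      by (subst w) (auto simp: norm_mult intro!: order_trans[OF norm_sum])
    also have "\<dots> \<le> (\<Sum>j\<le>n. norm (h j) * M)"
      using n by (intro sum_mono mult_left_mono M) auto
    also have "\<dots> \<le> (\<Sum>j\<le>N. norm (h j) * M)"
      using n \<open>M \<ge> 0\<close> by (intro sum_mono2) auto
    also have "\<dots> \<le> \<epsilon> * M"
      using h \<open>M \<ge> 0\<close> by (simp add: sum_distrib_right[symmetric] mult_right_mono)
    finally show ?thesis .
  qed
  have "M \<in> (\<lambda>n. norm (w n)) ` {..N}"
    unfolding M_def by (intro Max_in) auto
  then obtain n where n: "n \<le> N" "M = norm (w n)" by auto
  have "M \<le> 1 + \<epsilon> * M"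
    using diff[OF n(1)] u[of n] norm_triangle_sub[of "w n" "u n"] n(2) by linarith
  moreover have "\<epsilon> * M \<le> 1/2 * M" using \<epsilon> \<open>M \<ge> 0\<close> by (intro mult_right_mono)
  ultimately have "M \<le> 2" by linarith
  moreover have "\<epsilon> \<ge> 0" using h by (meson sum_nonneg norm_ge_zero order_trans)
  ultimately show ?thesis using diff[of N] mult_left_mono[of M 2 \<epsilon>] by simp
qed

text \<open>Taylor expansion of exp to second order. The condition that s^2 k is at most 1 bounds
  the real part of \<open>z\<close> by V / 2, so the remainder carries only the constant exp (V /
  2). The drift is already of second order in s; its product with the mark and its square join the
  cubic error.\<close>

lemma exp_drift_bounds:
  fixes s y V L :: real and k :: nat
  assumes s: "0 \<le> s" "s \<le> 1" and k: "1 \<le> k" "s\<^sup>2 * real k \<le> 1"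
    and y: "\<bar>y\<bar> \<le> L * real k" and V: "0 \<le> V" and L: "0 \<le> L"
  defines "z \<equiv> \<i> * of_real (s * y) + of_real (V * s\<^sup>2 * real k / 2)"
    and "D \<equiv> L + V / 2"
  shows "norm (exp z - 1) \<le> exp (V / 2) * D * (s * real k)"
    and "norm (exp z - 1 - (\<i> * of_real (s * y) + of_real (s\<^sup>2 / 2 * (V * real k - y\<^sup>2))))
           \<le> (exp (V / 2) * D ^ 3 + D\<^sup>2) * (s * real k) ^ 3"
proof -
  define \<kappa> where "\<kappa> = V * s\<^sup>2 * real k / 2"
  have \<kappa>0: "0 \<le> \<kappa>" unfolding \<kappa>_def using V by simp
  have "\<kappa> = V / 2 * (s\<^sup>2 * real k)" by (simp add: \<kappa>_def)
  also have "\<dots> \<le> V / 2 * 1" using V k(2) by (intro mult_left_mono) auto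
  finally have \<kappa>V: "\<kappa> \<le> V / 2" by simp
  have s2: "s\<^sup>2 \<le> s" using s by (simp add: power2_eq_square mult_left_le)
  have \<kappa>s: "\<kappa> \<le> V / 2 * (s * real k)"
    using mult_left_mono[OF mult_right_mono[OF s2, of "real k"], of "V/2"] V by (simp add: \<kappa>_def)
  have sy: "\<bar>s * y\<bar> \<le> L * (s * real k)"
    using mult_left_mono[OF y s(1)] s by (simp add: abs_mult mult_ac)
  have D0: "0 \<le> D" using L V by (simp add: D_def)
  have z: "z = \<i> * of_real (s * y) + of_real \<kappa>" by (simp add: z_def \<kappa>_def)
  have "norm z \<le> \<bar>s * y\<bar> + \<kappa>"
    unfolding z by (rule order_trans[OF norm_triangle_ineq]) (use \<kappa>0 in \<open>simp add: norm_mult del: of_real_mult\<close>)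
  also have "\<dots> \<le> D * (s * real k)"
    using sy \<kappa>s by (simp add: D_def algebra_simps)
  finally have nz: "norm z \<le> D * (s * real k)" .
  have Rez: "Re z = \<kappa>" by (simp add: z)
  have ez: "exp \<bar>Re z\<bar> \<le> exp (V / 2)" using Rez \<kappa>0 \<kappa>V by simp
  have "norm (exp z - 1) \<le> exp \<bar>Re z\<bar> * norm z" using Taylor_exp[of z 0] by simp
  also have "\<dots> \<le> exp (V / 2) * (D * (s * real k))"
    using ez nz by (intro mult_mono) auto
  finally show "norm (exp z - 1) \<le> exp (V / 2) * D * (s * real k)" by (simp add: mult_ac)
  have "norm (exp z - (1 + z + z\<^sup>2 / 2)) \<le> exp \<bar>Re z\<bar> * norm z ^ 3 / 2"
    using Taylor_exp[of z 2] by (simp add: eval_nat_numeral)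
  also have "\<dots> \<le> exp \<bar>Re z\<bar> * norm z ^ 3" by simp
  also have "\<dots> \<le> exp (V / 2) * (D * (s * real k)) ^ 3"
    using ez nz by (intro mult_mono power_mono) auto
  finally have A: "norm (exp z - (1 + z + z\<^sup>2 / 2)) \<le> exp (V / 2) * D ^ 3 * (s * real k) ^ 3"
    by (simp add: power_mult_distrib mult_ac)
  define d where "d = \<i> * of_real (s * y) * of_real \<kappa> + of_real (\<kappa>\<^sup>2 / 2)"
  have Bid: "z\<^sup>2 / 2 = d - of_real (s\<^sup>2 / 2 * y\<^sup>2)"
    unfolding z d_def by (simp add: field_simps power2_eq_square)
  have "norm d \<le> \<bar>s * y\<bar> * \<kappa> + \<kappa>\<^sup>2 / 2"
    unfolding d_def by (rule order_trans[OF norm_triangle_ineq]) (use \<kappa>0 in \<open>simp add: norm_mult norm_power norm_divide abs_mult del: of_real_power\<close>)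
  also have "\<dots> \<le> D * (s * real k) * \<kappa> "
  proof -
    have "\<kappa>\<^sup>2 / 2 \<le> V/2 * (s * real k) * \<kappa>"
      using mult_right_mono[OF \<kappa>s \<kappa>0] zero_le_square[of \<kappa>] unfolding power2_eq_square by linarith
    moreover have "\<bar>s * y\<bar> * \<kappa> \<le> L * (s * real k) * \<kappa>" by (intro mult_right_mono sy \<kappa>0)
    ultimately show ?thesis by (simp add: D_def algebra_simps)
  qed
  \<comment> \<open>One order is gained here: since k \<ge> 1, the drift is bounded by the square of
    s k and not merely by s k.\<close>
  also have "\<dots> \<le> D * (s * real k) * (D * (s * real k)\<^sup>2)"
  proof (rule mult_left_mono)
    have "\<kappa> \<le> D * (s\<^sup>2 * real k)"
      using L by (simp add: D_def \<kappa>_def algebra_simps)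
    also have "\<dots> \<le> D * (s\<^sup>2 * (real k)\<^sup>2)"
      using k(1) D0 by (intro mult_left_mono) (auto simp: power2_eq_square)
    finally show "\<kappa> \<le> D * (s * real k)\<^sup>2" by (simp add: power_mult_distrib)
  qed (use D0 s in simp)
  finally have B: "norm d \<le> D\<^sup>2 * (s * real k) ^ 3"
    by (simp add: power2_eq_square power3_eq_cube mult_ac)
  have "exp z - 1 - (\<i> * of_real (s * y) + of_real (s\<^sup>2 / 2 * (V * real k - y\<^sup>2))) =
     (exp z - (1 + z + z\<^sup>2 / 2)) + d"
    unfolding Bid by (simp add: z \<kappa>_def algebra_simps diff_divide_distrib)
  with order_trans[OF norm_triangle_ineq add_mono[OF A B]]
  show "norm (exp z - 1 - (\<i> * of_real (s * y) + of_real (s\<^sup>2 / 2 * (V * real k - y\<^sup>2))))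
           \<le> (exp (V / 2) * D ^ 3 + D\<^sup>2) * (s * real k) ^ 3"
    by (simp only: distrib_right)
qed

lemma sum_convolution_le:
  fixes a b :: "nat \<Rightarrow> real"
  assumes "\<And>n. 0 \<le> a n" "\<And>n. 0 \<le> b n"
  shows "(\<Sum>j\<le>N. \<Sum>k\<le>j. a k * b (j - k)) \<le> (\<Sum>k\<le>N. a k) * (\<Sum>k\<le>N. b k)"
proof -
  have "(\<Sum>j\<le>N. \<Sum>k\<le>j. a k * b (j - k)) = (\<Sum>(i,j)\<in>{(i,j). i + j \<le> N}. a i * b j)"
    by (rule sum.triangle_reindex_eq[symmetric])
  also have "\<dots> \<le> (\<Sum>(i,j)\<in>{..N} \<times> {..N}. a i * b j)"
    using assms by (intro sum_mono2) auto
  also have "\<dots> = (\<Sum>k\<le>N. a k) * (\<Sum>k\<le>N. b k)"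
    by (simp add: sum_product sum.cartesian_product)
  finally show ?thesis .
qed

text \<open>After exchanging the sums, \<open>f k\<close> is counted once for each j < k, so at most
  k times: summing tails costs one moment.\<close>

lemma sum_tails_le:
  fixes f :: "nat \<Rightarrow> real"
  assumes f: "\<And>k. 0 \<le> f k" and s: "summable (\<lambda>k. real k * f k)"
  shows "summable (\<lambda>k. if j < k then f k else 0)"
    and "(\<Sum>j\<le>N. \<Sum>k. if j < k then f k else 0) \<le> (\<Sum>k. real k * f k)"
proof -
  have le: "f k \<le> real k * f k" if "0 < k" for k
    using that f mult_right_mono[of 1 "real k" "f k"] by auto
  show sm: "summable (\<lambda>k. if j < k then f k else 0)" for j
    by (rule summable_comparison_test'[OF s, of 0]) (use f le in auto)
  have "(\<Sum>j\<le>N. \<Sum>k. if j < k then f k else 0) = (\<Sum>k. \<Sum>j\<le>N. if j < k then f k else 0)"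
    by (rule suminf_sum[symmetric]) (rule sm)
  also have "\<dots> \<le> (\<Sum>k. real k * f k)"
  proof (rule suminf_le[OF _ summable_sum[OF sm] s])
    fix k
    have "(\<Sum>j\<le>N. if j < k then f k else 0) = real (card {j\<in>{..N}. j < k}) * f k"
      by (subst sum.inter_filter[symmetric]) auto
    also have "\<dots> \<le> real k * f k"
    proof -
      have "card {j\<in>{..N}. j < k} \<le> card {..<k}"
        by (intro card_mono) auto
      then show ?thesis
        using f by (intro mult_right_mono) auto
    qed
    finally show "(\<Sum>j\<le>N. if j < k then f k else 0) \<le> real k * f k" .
  qed
  finally show "(\<Sum>j\<le>N. \<Sum>k. if j < k then f k else 0) \<le> (\<Sum>k. real k * f k)" .
qed

text \<open>The renewal structure stripped of permutations: \<open>B k\<close> holds the blocks of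
  length k with weights \<open>\<omega>\<close> and marks \<open>y\<close>, \<open>u n\<close> is
  the total weight of the block sequences of length n, and \<open>v s\<close> is its Fourier
  transform in the sum of the marks. \<open>V\<close> is a variance per unit of length, not per
  block.\<close>

locale marked_renewal =
  fixes B :: "nat \<Rightarrow> 'b set" and \<omega> :: "nat \<Rightarrow> 'b \<Rightarrow> real" and y :: "nat \<Rightarrow> 'b \<Rightarrow> real"
    and p :: "nat \<Rightarrow> real" and u :: "nat \<Rightarrow> real" and v :: "real \<Rightarrow> nat \<Rightarrow> complex"
    and L V c :: real
  assumes B0: "B 0 = {}"
    and \<omega>: "\<And>k b. b \<in> B k \<Longrightarrow> 0 \<le> \<omega> k b"
    and p: "\<And>k. p k = (\<Sum>b\<in>B k. \<omega> k b)"
    and p3: "summable (\<lambda>k. real k ^ 3 * p k)"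
    and L: "0 \<le> L" and y: "\<And>k b. b \<in> B k \<Longrightarrow> \<bar>y k b\<bar> \<le> L * real k"
    and V: "0 \<le> V"
    and mean: "(\<Sum>k. \<Sum>b\<in>B k. \<omega> k b * y k b) = 0"
    and var: "(\<Sum>k. \<Sum>b\<in>B k. \<omega> k b * (y k b)\<^sup>2) = V * (\<Sum>k. real k * p k)"
    and u_rec: "\<And>n. u n = (if n = 0 then 1 else 0) + (\<Sum>k\<le>n. p k * u (n - k))"
    and u1: "\<And>n. \<bar>u n\<bar> \<le> 1"
    and c: "0 \<le> c" "c \<le> 1"
    and uc: "summable (\<lambda>n. \<bar>u n - c\<bar>)"
    and v_rec: "\<And>s n. v s n = (if n = 0 then 1 else 0)
        + (\<Sum>k\<le>n. (\<Sum>b\<in>B k. of_real (\<omega> k b) * cis (s * y k b)) * v s (n - k))"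
begin

lemma p_nonneg: "0 \<le> p k"
  unfolding p by (intro sum_nonneg \<omega>)

text \<open>Guarantees that the sums in \<open>mean\<close> and \<open>var\<close> are values of
  convergent series and not defaults of \<open>suminf\<close>: marks grow at most linearly, so the
  cube dominates their first two powers.\<close>

lemma summable_dominated:
  assumes "\<And>k b. b \<in> B k \<Longrightarrow> \<bar>f k b\<bar> \<le> C * real k ^ 3"
  shows "summable (\<lambda>k. \<Sum>b\<in>B k. \<omega> k b * f k b)"
proof (rule summable_comparison_test'[OF summable_mult[OF p3, of C], of 0])
  fix k
  have "norm (\<Sum>b\<in>B k. \<omega> k b * f k b) \<le> (\<Sum>b\<in>B k. \<omega> k b * (C * real k ^ 3))"
    by (rule order_trans[OF norm_sum], rule sum_mono)
       (use \<omega> assms in \<open>auto simp: abs_mult intro!: mult_left_mono\<close>)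
  also have "\<dots> = C * (real k ^ 3 * p k)"
    by (simp add: p sum_distrib_left sum_distrib_right mult_ac)
  finally show "norm (\<Sum>b\<in>B k. \<omega> k b * f k b) \<le> C * (real k ^ 3 * p k)" .
qed

lemma power_le_cube: "i \<le> 3 \<Longrightarrow> 0 < i \<Longrightarrow> real k ^ i \<le> real k ^ 3"
  by (cases "k = 0") (auto intro: power_increasing simp: zero_power)

lemma summable_power_p: "i \<le> 3 \<Longrightarrow> 0 < i \<Longrightarrow> summable (\<lambda>k. real k ^ i * p k)"
  by (rule summable_comparison_test'[OF p3, of 0])
     (auto simp: p_nonneg abs_mult intro!: mult_right_mono power_le_cube)

section \<open>Size of the kernel perturbation\<close>

definition D where "D = L + V / 2"
definition E where "E = exp (V / 2) * D ^ 3 + D\<^sup>2"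
definition F where "F = L + (V + L\<^sup>2) / 2"
text \<open>The kernel of the renewal equation solved by the tilted \<open>v\<close>; at s = 0 it
  reduces to \<open>p\<close>.\<close>

definition \<gamma> where "\<gamma> s k = (\<Sum>b\<in>B k. of_real (\<omega> k b) *
    exp (\<i> * of_real (s * y k b) + of_real (V * s\<^sup>2 * real k / 2)))"
text \<open>The terms of first and second order in s of \<open>\<gamma> s k - p k\<close>. They need
  not vanish for a single k, only in the sum over all k.\<close>

definition \<delta> where "\<delta> s k = \<i> * of_real (s * (\<Sum>b\<in>B k. \<omega> k b * y k b))
    + of_real (s\<^sup>2 / 2 * (V * (real k * p k) - (\<Sum>b\<in>B k. \<omega> k b * (y k b)\<^sup>2)))"
definition H where "H s j = (\<Sum>k\<le>j. (\<gamma> s k - of_real (p k)) * of_real (u (j - k)))"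
text \<open>Collects three contributions to the sum of the norms of \<open>H s\<close>:
  \<open>F\<close> from the tails of \<open>\<delta>\<close>, \<open>2 * E\<close> from the cubic
  remainder, and the last summand from the convolution with \<open>u - c\<close>.\<close>

definition K where "K = (F + 2 * E) * (\<Sum>k. real k ^ 3 * p k)
    + exp (V / 2) * D * (\<Sum>k. real k * p k) * (\<Sum>n. \<bar>u n - c\<bar>)"

lemma D_nonneg: "0 \<le> D" and E_nonneg: "0 \<le> E" and F_nonneg: "0 \<le> F"
  using L V by (auto simp: D_def E_def F_def)

lemma summable_y: "summable (\<lambda>k. \<Sum>b\<in>B k. \<omega> k b * y k b)"
proof (rule summable_dominated[of _ L])
  fix k b assume b: "b \<in> B k"
  have "L * real k ^ 1 \<le> L * real k ^ 3" using L by (intro mult_left_mono power_le_cube) auto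
  then show "\<bar>y k b\<bar> \<le> L * real k ^ 3" using y[OF b] by simp
qed

lemma y_sq: "b \<in> B k \<Longrightarrow> (y k b)\<^sup>2 \<le> L\<^sup>2 * (real k)\<^sup>2"
  using power_mono[OF y[of b k] abs_ge_zero, of 2] by (simp add: power_mult_distrib)

lemma summable_y2: "summable (\<lambda>k. \<Sum>b\<in>B k. \<omega> k b * (y k b)\<^sup>2)"
proof (rule summable_dominated[of _ "L\<^sup>2"])
  fix k b assume b: "b \<in> B k"
  have "L\<^sup>2 * real k ^ 2 \<le> L\<^sup>2 * real k ^ 3" using L by (intro mult_left_mono power_le_cube) auto
  then show "\<bar>(y k b)\<^sup>2\<bar> \<le> L\<^sup>2 * real k ^ 3" using y_sq[OF b] by simp
qed

lemma \<gamma>_diff: "\<gamma> s k - of_real (p k) = (\<Sum>b\<in>B k. of_real (\<omega> k b) *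
    (exp (\<i> * of_real (s * y k b) + of_real (V * s\<^sup>2 * real k / 2)) - 1))"
  by (simp add: \<gamma>_def p algebra_simps sum_subtractf)

lemma \<gamma>_bounds:
  assumes s: "0 \<le> s" "s \<le> 1" and k: "s\<^sup>2 * real k \<le> 1"
  shows "norm (\<gamma> s k - of_real (p k)) \<le> exp (V / 2) * D * s * (real k * p k)"
    and "norm (\<gamma> s k - of_real (p k) - \<delta> s k) \<le> E * s ^ 3 * (real k ^ 3 * p k)"
proof -
  have k1: "1 \<le> k" if "b \<in> B k" for b using that B0 by (cases k) auto
  note bd = exp_drift_bounds[OF s k1 k y V L]
  have "norm (\<gamma> s k - of_real (p k)) \<le> (\<Sum>b\<in>B k. \<omega> k b * (exp (V / 2) * D * (s * real k)))"
    unfolding \<gamma>_diff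
  proof (rule order_trans[OF norm_sum], rule sum_mono)
    fix b assume b: "b \<in> B k"
    show "norm (of_real (\<omega> k b) * (exp (\<i> * of_real (s * y k b) + of_real (V * s\<^sup>2 * real k / 2)) - 1))
      \<le> \<omega> k b * (exp (V / 2) * D * (s * real k))"
      using mult_left_mono[OF bd(1)[OF b b] \<omega>[OF b]] \<omega>[OF b]
      unfolding norm_mult norm_of_real D_def by simp
  qed
  also have "\<dots> = exp (V / 2) * D * s * (real k * p k)"
    by (simp add: p sum_distrib_left sum_distrib_right mult_ac)
  finally show "norm (\<gamma> s k - of_real (p k)) \<le> exp (V / 2) * D * s * (real k * p k)" .
  have "s * (\<Sum>b\<in>B k. \<omega> k b * y k b) = (\<Sum>b\<in>B k. \<omega> k b * (s * y k b))"
    by (simp add: sum_distrib_left mult_ac)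
  moreover have "s\<^sup>2 / 2 * (V * (real k * p k) - (\<Sum>b\<in>B k. \<omega> k b * (y k b)\<^sup>2))
      = (\<Sum>b\<in>B k. \<omega> k b * (s\<^sup>2 / 2 * (V * real k - (y k b)\<^sup>2)))"
    by (simp add: p sum_distrib_left sum_distrib_right right_diff_distrib sum_subtractf mult_ac)
  ultimately have \<delta>: "\<delta> s k = (\<Sum>b\<in>B k. of_real (\<omega> k b) *
      (\<i> * of_real (s * y k b) + of_real (s\<^sup>2 / 2 * (V * real k - (y k b)\<^sup>2))))"
    by (simp only: \<delta>_def of_real_sum of_real_mult[of "\<omega> k b" for b])
       (simp only: sum_distrib_left sum.distrib[symmetric] ring_distribs(1) mult.left_commute)
  have split: "\<gamma> s k - of_real (p k) - \<delta> s k = (\<Sum>b\<in>B k. of_real (\<omega> k b) *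
    (exp (\<i> * of_real (s * y k b) + of_real (V * s\<^sup>2 * real k / 2)) - 1
      - (\<i> * of_real (s * y k b) + of_real (s\<^sup>2 / 2 * (V * real k - (y k b)\<^sup>2)))))"
    unfolding \<gamma>_diff \<delta> sum_subtractf[symmetric] right_diff_distrib ..
  have "norm (\<gamma> s k - of_real (p k) - \<delta> s k) \<le> (\<Sum>b\<in>B k. \<omega> k b * (E * (s * real k) ^ 3))"
    unfolding split
  proof (rule order_trans[OF norm_sum], rule sum_mono)
    fix b assume b: "b \<in> B k"
    show "norm (of_real (\<omega> k b) * (exp (\<i> * of_real (s * y k b) + of_real (V * s\<^sup>2 * real k / 2)) - 1
      - (\<i> * of_real (s * y k b) + of_real (s\<^sup>2 / 2 * (V * real k - (y k b)\<^sup>2)))))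
      \<le> \<omega> k b * (E * (s * real k) ^ 3)"
      using mult_left_mono[OF bd(2)[OF b b] \<omega>[OF b]] \<omega>[OF b]
      unfolding norm_mult norm_of_real E_def D_def by simp
  qed
  also have "\<dots> = E * s ^ 3 * (real k ^ 3 * p k)"
    unfolding p sum_distrib_left power_mult_distrib by (simp only: mult_ac)
  finally show "norm (\<gamma> s k - of_real (p k) - \<delta> s k) \<le> E * s ^ 3 * (real k ^ 3 * p k)" .
qed

text \<open>Both orders are put under one bound by giving away s^2 as s and k as k^2; this leaves
  one of the three available moments for the summation of tails.\<close>

lemma \<delta>_bound:
  assumes s: "0 \<le> s" "s \<le> 1"
  shows "norm (\<delta> s k) \<le> F * s * ((real k)\<^sup>2 * p k)"
proof -
  let ?a = "\<Sum>b\<in>B k. \<omega> k b * y k b" and ?b = "\<Sum>b\<in>B k. \<omega> k b * (y k b)\<^sup>2"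
  have k2: "real k \<le> (real k)\<^sup>2" by (cases k) (auto simp: power2_eq_square)
  have "\<bar>?a\<bar> \<le> (\<Sum>b\<in>B k. \<omega> k b * (L * real k))"
    by (rule order_trans[OF sum_abs], rule sum_mono) (use \<omega> y in \<open>auto simp: abs_mult intro!: mult_left_mono\<close>)
  also have "\<dots> = L * (real k * p k)" by (simp add: p sum_distrib_left sum_distrib_right mult_ac)
  also have "\<dots> \<le> L * ((real k)\<^sup>2 * p k)"
    using L k2 p_nonneg by (intro mult_left_mono mult_right_mono) auto
  finally have a: "\<bar>?a\<bar> \<le> L * ((real k)\<^sup>2 * p k)" .
  have b0: "0 \<le> ?b" using \<omega> by (intro sum_nonneg) auto
  have "?b \<le> (\<Sum>b\<in>B k. \<omega> k b * (L\<^sup>2 * (real k)\<^sup>2))"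
    by (rule sum_mono) (use \<omega> y_sq in \<open>auto intro!: mult_left_mono\<close>)
  also have "\<dots> = L\<^sup>2 * ((real k)\<^sup>2 * p k)" by (simp add: p sum_distrib_left sum_distrib_right mult_ac)
  finally have b: "?b \<le> L\<^sup>2 * ((real k)\<^sup>2 * p k)" .
  have d: "V * (real k * p k) \<le> V * ((real k)\<^sup>2 * p k)"
    using V k2 p_nonneg by (intro mult_left_mono mult_right_mono) auto
  have d0: "0 \<le> V * (real k * p k)" using V p_nonneg by simp
  have s2: "s\<^sup>2 \<le> s" using s by (simp add: power2_eq_square mult_left_le)
  have "norm (\<delta> s k) \<le> \<bar>s * ?a\<bar> + \<bar>s\<^sup>2 / 2 * (V * (real k * p k) - ?b)\<bar>"
    unfolding \<delta>_def by (rule order_trans[OF norm_triangle_ineq]) (simp only: norm_mult norm_of_real norm_ii mult_1 order_refl)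
  also have "\<dots> = s * \<bar>?a\<bar> + s\<^sup>2 / 2 * \<bar>V * (real k * p k) - ?b\<bar>"
    using s by (simp add: abs_mult)
  also have "\<dots> \<le> s * (L * ((real k)\<^sup>2 * p k)) + s / 2 * (V * ((real k)\<^sup>2 * p k) + L\<^sup>2 * ((real k)\<^sup>2 * p k))"
    using s a b b0 d d0 s2 by (intro add_mono mult_mono) auto
  also have "\<dots> = F * s * ((real k)\<^sup>2 * p k)" by (simp add: F_def field_simps)
  finally show ?thesis .
qed

text \<open>The first-order part vanishes by \<open>mean\<close>, the second-order part by
  \<open>var\<close>: this is the cancellation for which the tilt is chosen.\<close>

lemma \<delta>_sums: "\<delta> s sums 0"
proof -
  have "(\<lambda>k. \<i> * of_real (s * (\<Sum>b\<in>B k. \<omega> k b * y k b))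
    + of_real (s\<^sup>2 / 2 * (V * (real k * p k) - (\<Sum>b\<in>B k. \<omega> k b * (y k b)\<^sup>2)))) sums
    (\<i> * of_real (s * 0) + of_real (s\<^sup>2 / 2 * (V * (\<Sum>k. real k * p k) - V * (\<Sum>k. real k * p k))))"
    using summable_sums[OF summable_y] summable_sums[OF summable_y2]
      summable_sums[OF summable_power_p[of 1]]
    unfolding mean var by (intro sums_add sums_mult sums_of_real sums_diff) simp_all
  then show ?thesis by (simp add: \<delta>_def[abs_def])
qed

text \<open>Since the whole series is 0, a partial sum is minus the remaining tail.\<close>

lemma \<delta>_partial_sum:
  assumes s: "0 \<le> s" "s \<le> 1"
  shows "norm (\<Sum>k\<le>j. \<delta> s k) \<le> F * s * (\<Sum>k. if j < k then (real k)\<^sup>2 * p k else 0)"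
proof -
  have s3: "summable (\<lambda>k. real k * ((real k)\<^sup>2 * p k))" using p3 by (simp add: eval_nat_numeral mult_ac)
  note sm = sum_tails_le(1)[OF _ s3, of j]
  have "(\<lambda>k. if k \<in> {..j} then \<delta> s k else 0) sums (\<Sum>k\<le>j. \<delta> s k)"
    by (rule sums_If_finite_set) simp
  from sums_diff[OF this \<delta>_sums[of s]]
  have "(\<lambda>k. (if k \<in> {..j} then \<delta> s k else 0) - \<delta> s k) sums (\<Sum>k\<le>j. \<delta> s k)"
    by simp
  also have "(\<lambda>k. (if k \<in> {..j} then \<delta> s k else 0) - \<delta> s k) = (\<lambda>k. if j < k then - \<delta> s k else 0)"
    by auto
  finally have "(\<lambda>k. if j < k then - \<delta> s k else 0) sums (\<Sum>k\<le>j. \<delta> s k)" .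
  then have "(\<Sum>k\<le>j. \<delta> s k) = (\<Sum>k. if j < k then - \<delta> s k else 0)"
    by (rule sums_unique)
  also have "norm \<dots> \<le> (\<Sum>k. F * s * (if j < k then (real k)\<^sup>2 * p k else 0))"
    by (rule norm_suminf_le) (use sm p_nonneg \<delta>_bound[OF s] in \<open>auto intro!: summable_mult\<close>)
  also have "\<dots> = F * s * (\<Sum>k. if j < k then (real k)\<^sup>2 * p k else 0)"
    by (rule suminf_mult) (use sm p_nonneg in auto)
  finally show ?thesis .
qed

lemma H_sum_bound:
  assumes s: "0 \<le> s" "s \<le> 1" and N: "s\<^sup>2 * real N \<le> 1"
  shows "(\<Sum>j\<le>N. norm (H s j)) \<le> K * s"
proof -
  define M3 where "M3 = (\<Sum>k. real k ^ 3 * p k)"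
  define \<rho> where "\<rho> j = (\<Sum>k. if j < k then (real k)\<^sup>2 * p k else 0)" for j
  have M3: "0 \<le> M3" unfolding M3_def by (intro suminf_nonneg p3) (simp add: p_nonneg)
  have k: "s\<^sup>2 * real k \<le> 1" if "k \<le> N" for k
    using N mult_left_mono[of "real k" "real N" "s\<^sup>2"] that by simp
  have G: "norm (\<Sum>k\<le>j. \<gamma> s k - of_real (p k)) \<le> F * s * \<rho> j + E * s ^ 3 * M3" if j: "j \<le> N" for j
  proof -
    have "norm (\<Sum>k\<le>j. \<gamma> s k - of_real (p k) - \<delta> s k) \<le> (\<Sum>k\<le>j. E * s ^ 3 * (real k ^ 3 * p k))"
      by (rule order_trans[OF norm_sum], rule sum_mono, rule \<gamma>_bounds(2)[OF s k]) (use j in simp)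
    also have "\<dots> = E * s ^ 3 * (\<Sum>k\<le>j. real k ^ 3 * p k)" by (simp add: sum_distrib_left)
    also have "\<dots> \<le> E * s ^ 3 * M3"
      unfolding M3_def using E_nonneg s p_nonneg by (intro mult_left_mono sum_le_suminf p3) auto
    finally have rest: "norm (\<Sum>k\<le>j. \<gamma> s k - of_real (p k) - \<delta> s k) \<le> E * s ^ 3 * M3" .
    have split: "(\<Sum>k\<le>j. \<gamma> s k - of_real (p k)) =
        (\<Sum>k\<le>j. \<delta> s k) + (\<Sum>k\<le>j. \<gamma> s k - of_real (p k) - \<delta> s k)"
      by (simp add: sum.distrib[symmetric])
    show ?thesis
      unfolding split \<rho>_def
      by (rule order_trans[OF norm_triangle_ineq add_mono[OF \<delta>_partial_sum[OF s] rest]])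
  qed
  have Hle: "norm (H s j) \<le> (F * s * \<rho> j + E * s ^ 3 * M3)
      + (\<Sum>k\<le>j. norm (\<gamma> s k - of_real (p k)) * \<bar>u (j - k) - c\<bar>)" if j: "j \<le> N" for j
  proof -
    \<comment> \<open>Freezing \<open>u\<close> at its limit leaves partial sums of the kernel
      difference, which \<open>G\<close> covers. The error \<open>u - c\<close> is absolutely
      summable, so for it the crude bound of order s on the kernel difference suffices.\<close>
    have split: "H s j = of_real c * (\<Sum>k\<le>j. \<gamma> s k - of_real (p k))
        + (\<Sum>k\<le>j. (\<gamma> s k - of_real (p k)) * of_real (u (j - k) - c))"
      unfolding H_def sum_distrib_left by (simp add: sum.distrib[symmetric] algebra_simps)
    have "norm (of_real c * (\<Sum>k\<le>j. \<gamma> s k - of_real (p k))) \<le> 1 * (F * s * \<rho> j + E * s ^ 3 * M3)"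
      unfolding norm_mult norm_of_real abs_of_nonneg[OF c(1)] using c G[OF j] by (intro mult_mono) auto
    moreover have "norm (\<Sum>k\<le>j. (\<gamma> s k - of_real (p k)) * of_real (u (j - k) - c)) \<le>
        (\<Sum>k\<le>j. norm (\<gamma> s k - of_real (p k)) * \<bar>u (j - k) - c\<bar>)"
      by (rule order_trans[OF norm_sum], rule sum_mono) (simp add: norm_mult del: of_real_diff)
    ultimately show ?thesis
      unfolding split mult_1 by (rule order_trans[OF norm_triangle_ineq add_mono])
  qed
  have "(\<Sum>j\<le>N. norm (H s j)) \<le> (\<Sum>j\<le>N. (F * s * \<rho> j + E * s ^ 3 * M3)
      + (\<Sum>k\<le>j. norm (\<gamma> s k - of_real (p k)) * \<bar>u (j - k) - c\<bar>))"
    by (rule sum_mono) (use Hle in auto)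
  also have "\<dots> = F * s * (\<Sum>j\<le>N. \<rho> j) + E * s * M3 * (s\<^sup>2 * (real N + 1))
      + (\<Sum>j\<le>N. \<Sum>k\<le>j. norm (\<gamma> s k - of_real (p k)) * \<bar>u (j - k) - c\<bar>)"
    by (simp add: sum.distrib sum_distrib_left power2_eq_square power3_eq_cube algebra_simps)
  finally have 1: "(\<Sum>j\<le>N. norm (H s j)) \<le> F * s * (\<Sum>j\<le>N. \<rho> j) + E * s * M3 * (s\<^sup>2 * (real N + 1))
      + (\<Sum>j\<le>N. \<Sum>k\<le>j. norm (\<gamma> s k - of_real (p k)) * \<bar>u (j - k) - c\<bar>)" .
  have "(\<Sum>j\<le>N. \<rho> j) \<le> M3"
    using sum_tails_le(2)[of "\<lambda>k. (real k)\<^sup>2 * p k" N] p3 p_nonneg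
    by (simp add: \<rho>_def M3_def eval_nat_numeral mult_ac)
  then have 2: "F * s * (\<Sum>j\<le>N. \<rho> j) \<le> F * s * M3"
    using F_nonneg s by (intro mult_left_mono) auto
  \<comment> \<open>There are N + 1 indices, not N; this is the origin of the factor 2 before
    \<open>E\<close> in \<open>K\<close>.\<close>
  have "s\<^sup>2 * (real N + 1) \<le> 2"
    using N s power_le_one[of s 2] by (simp add: algebra_simps)
  then have 3: "E * s * M3 * (s\<^sup>2 * (real N + 1)) \<le> E * s * M3 * 2"
    using E_nonneg s M3 by (intro mult_left_mono) auto
  have "(\<Sum>j\<le>N. \<Sum>k\<le>j. norm (\<gamma> s k - of_real (p k)) * \<bar>u (j - k) - c\<bar>) \<le>
      (\<Sum>k\<le>N. norm (\<gamma> s k - of_real (p k))) * (\<Sum>k\<le>N. \<bar>u k - c\<bar>)"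
    by (rule sum_convolution_le) auto
  also have "\<dots> \<le> (exp (V / 2) * D * s * (\<Sum>k. real k * p k)) * (\<Sum>n. \<bar>u n - c\<bar>)"
  proof (rule mult_mono)
    have "(\<Sum>k\<le>N. norm (\<gamma> s k - of_real (p k))) \<le> (\<Sum>k\<le>N. exp (V / 2) * D * s * (real k * p k))"
      by (rule sum_mono, rule \<gamma>_bounds(1)[OF s k]) simp
    also have "\<dots> = exp (V / 2) * D * s * (\<Sum>k\<le>N. real k * p k)" by (simp add: sum_distrib_left)
    also have "\<dots> \<le> exp (V / 2) * D * s * (\<Sum>k. real k * p k)"
      using D_nonneg s p_nonneg summable_power_p[of 1] by (intro mult_left_mono sum_le_suminf) auto
    finally show "(\<Sum>k\<le>N. norm (\<gamma> s k - of_real (p k))) \<le> exp (V / 2) * D * s * (\<Sum>k. real k * p k)" .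
    show "(\<Sum>k\<le>N. \<bar>u k - c\<bar>) \<le> (\<Sum>n. \<bar>u n - c\<bar>)"
      by (intro sum_le_suminf uc) auto
    show "0 \<le> exp (V / 2) * D * s * (\<Sum>k. real k * p k)"
      using D_nonneg s p_nonneg summable_power_p[of 1] by (intro mult_nonneg_nonneg suminf_nonneg) auto
  qed (auto intro: sum_nonneg)
  finally have "(\<Sum>j\<le>N. norm (H s j)) \<le> F * s * M3 + E * s * M3 * 2
      + exp (V / 2) * D * s * (\<Sum>k. real k * p k) * (\<Sum>n. \<bar>u n - c\<bar>)"
    using 1 2 3 by linarith
  also have "\<dots> = K * s"
    by (simp add: K_def M3_def algebra_simps)
  finally show ?thesis .
qed

lemma v_limit: "(\<lambda>n. v (1 / sqrt (real n)) n) \<longlonglongrightarrow> of_real (c * exp (- V / 2))"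
proof -
  define e where "e n = K * (1 / sqrt (real n))" for n :: nat
  define w where "w s n = v s n * exp (of_real (V * s\<^sup>2 * real n / 2))" for s n
  have ulim: "u \<longlonglongrightarrow> c"
    using summable_LIMSEQ_zero[OF uc] by (simp add: tendsto_rabs_zero_iff LIM_zero_iff)
  have wrec: "w s n = (if n = 0 then 1 else 0) + (\<Sum>k\<le>n. \<gamma> s k * w s (n - k))" for s n
  proof -
    have "w s n = (if n = 0 then 1 else 0) + (\<Sum>k\<le>n. (\<Sum>b\<in>B k. of_real (\<omega> k b) * cis (s * y k b))
         * exp (of_real (V * s\<^sup>2 * real n / 2)) * v s (n - k))"
      unfolding w_def by (subst v_rec) (cases "n = 0"; simp add: B0 sum_distrib_left sum_distrib_right mult_ac)
    also have "(\<Sum>k\<le>n. (\<Sum>b\<in>B k. of_real (\<omega> k b) * cis (s * y k b))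
         * exp (of_real (V * s\<^sup>2 * real n / 2)) * v s (n - k)) = (\<Sum>k\<le>n. \<gamma> s k * w s (n - k))"
    proof (rule sum.cong[OF refl])
      fix k assume "k \<in> {..n}"
      \<comment> \<open>The exponent is linear in the length, so the tilt splits along n = k + (n -
        k) into one factor for the kernel and one for the remainder.\<close>
      then have *: "V * s\<^sup>2 * real n / 2 = V * s\<^sup>2 * real k / 2 + V * s\<^sup>2 * real (n - k) / 2"
        by (simp add: field_simps of_nat_diff)
      have "\<gamma> s k = (\<Sum>b\<in>B k. of_real (\<omega> k b) * cis (s * y k b)) * exp (of_real (V * s\<^sup>2 * real k / 2))"
        unfolding \<gamma>_def sum_distrib_right cis_conv_exp exp_add by (simp only: mult.assoc)
      then show "(\<Sum>b\<in>B k. of_real (\<omega> k b) * cis (s * y k b))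
         * exp (of_real (V * s\<^sup>2 * real n / 2)) * v s (n - k) = \<gamma> s k * w s (n - k)"
        unfolding * of_real_add exp_add w_def by (simp only: mult_ac)
    qed
    finally show ?thesis .
  qed
  have urec: "of_real (u n) = (if n = 0 then 1 else 0) + (\<Sum>k\<le>n. of_real (p k) * of_real (u (n - k)) :: complex)" for n
    by (subst u_rec) simp
  have bound: "norm (w (1 / sqrt (real n)) n - of_real (u n)) \<le> 2 * e n"
    if n: "1 \<le> n" and e: "e n \<le> 1 / 2" for n
  proof (rule renewal_stability[where h = "H (1 / sqrt (real n))" and w = "w (1 / sqrt (real n))"
        and u = "\<lambda>m. of_real (u m)"])
    show "w (1 / sqrt (real n)) m = of_real (u m) + (\<Sum>j\<le>m. H (1 / sqrt (real n)) j * w (1 / sqrt (real n)) (m - j))" for m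
      unfolding H_def by (rule renewal_perturbation[OF urec wrec])
    \<comment> \<open>For this s, the index n is the largest that the condition of
      \<open>H_sum_bound\<close> admits.\<close>
    show "(\<Sum>j\<le>n. norm (H (1 / sqrt (real n)) j)) \<le> e n"
      unfolding e_def by (rule H_sum_bound) (use n in \<open>simp_all add: power_divide\<close>)
  qed (use e u1 in simp_all)
  have e0: "e \<longlonglongrightarrow> 0"
    unfolding e_def by (rule tendsto_mult_right_zero) real_asymp
  have "(\<lambda>n. w (1 / sqrt (real n)) n - of_real (u n)) \<longlonglongrightarrow> 0"
  proof (rule Lim_null_comparison)
    have "eventually (\<lambda>n. e n < 1/2) sequentially" by (rule order_tendstoD(2)[OF e0]) simp
    then show "eventually (\<lambda>n. norm (w (1 / sqrt (real n)) n - of_real (u n)) \<le> 2 * e n) sequentially"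
      using eventually_ge_at_top[of 1] by eventually_elim (auto intro: bound)
    show "(\<lambda>n. 2 * e n) \<longlonglongrightarrow> 0" using tendsto_mult_left[OF e0, of 2] by simp
  qed
  from tendsto_add[OF this tendsto_of_real[OF ulim]]
  have "(\<lambda>n. w (1 / sqrt (real n)) n) \<longlonglongrightarrow> of_real c" by simp
  from tendsto_mult_right[OF this, of "of_real (exp (- V / 2))"]
  have "(\<lambda>n. w (1 / sqrt (real n)) n * of_real (exp (- V / 2))) \<longlonglongrightarrow> of_real (c * exp (- V / 2))" by simp
  moreover have "eventually (\<lambda>n. w (1 / sqrt (real n)) n * of_real (exp (- V / 2)) = v (1 / sqrt (real n)) n) sequentially"
    using eventually_ge_at_top[of 1]
  proof eventually_elim
    fix n :: nat assume "1 \<le> n"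
    then have "V * (1 / sqrt (real n))\<^sup>2 * real n / 2 = V / 2" by (simp add: power_divide)
    moreover have "exp (of_real (V / 2)) * of_real (exp (- V / 2)) = (1 :: complex)"
      unfolding exp_of_real[symmetric] by (simp only: exp_add[symmetric] of_real_add[symmetric]) simp
    ultimately show "w (1 / sqrt (real n)) n * of_real (exp (- V / 2)) = v (1 / sqrt (real n)) n"
      unfolding w_def by (simp only: mult.assoc mult_1_right)
  qed
  ultimately show ?thesis by (rule Lim_transform_eventually)
qed

end

section \<open>Direct sums of permutations\<close>

fun list_inversions :: "'a::linorder list \<Rightarrow> nat" where
  "list_inversions [] = 0"
| "list_inversions (x # xs) = length (filter (\<lambda>y. y < x) xs) + list_inversions xs"

lemma list_inversions_eq_card:
  "list_inversions xs = card {(i, j). i < j \<and> j < length xs \<and> xs ! j < xs ! i}"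
proof (induction xs)
  case (Cons x xs)
  let ?I = "\<lambda>xs. {(i, j). i < j \<and> j < length xs \<and> xs ! j < xs ! i}"
  have fin: "finite (?I xs)"
    by (rule finite_subset[of _ "{..<length xs} \<times> {..<length xs}"]) auto
  have eq: "?I (x # xs) = (\<lambda>j. (0, Suc j)) ` {j. j < length xs \<and> xs ! j < x} \<union> map_prod Suc Suc ` ?I xs"
    (is "_ = ?A \<union> ?B")
  proof (intro equalityI subsetI)
    fix a assume "a \<in> ?I (x # xs)"
    then obtain i j where a: "a = (i, j)" "i < j" "j < Suc (length xs)" "(x # xs) ! j < (x # xs) ! i" by auto
    then obtain j' where j: "j = Suc j'" by (cases j) auto
    show "a \<in> ?A \<union> ?B"
    proof (cases i)
      case (Suc i')
      then have "(i', j') \<in> ?I xs" using a j by auto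
      then show ?thesis using a j Suc by (auto simp: image_iff intro!: bexI[of _ "(i', j')"])
    qed (use a j in auto)
  qed auto
  have "card (?A \<union> ?B) = card ?A + card ?B"
    using fin by (intro card_Un_disjoint) auto
  also have "card ?A = card {j. j < length xs \<and> xs ! j < x}" by (intro card_image) (auto simp: inj_on_def)
  also have "card ?B = card (?I xs)" by (intro card_image) (auto simp: inj_on_def)
  finally show ?case using Cons eq by (simp add: length_filter_conv_card)
qed simp

lemma bij_betw_rank:
  fixes A :: "'a::linorder set"
  assumes "finite A"
  shows "bij_betw (\<lambda>x. card {y\<in>A. y < x}) A {..<card A}"
proof -
  let ?r = "\<lambda>x. card {y\<in>A. y < x}"
  have less: "?r x < ?r y" if "x \<in> A" "x < y" for x y
    using assms that by (intro psubset_card_mono) (auto intro: less_trans)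
  have inj: "inj_on ?r A"
  proof (rule inj_onI, rule ccontr)
    fix x y assume "x \<in> A" "y \<in> A" "?r x = ?r y" "x \<noteq> y"
    then show False using less[of x y] less[of y x] by (cases x y rule: linorder_cases) auto
  qed
  have "?r ` A \<subseteq> {..<card A}"
    using assms by (auto intro!: psubset_card_mono)
  moreover have "card (?r ` A) = card {..<card A}"
    using card_image[OF inj] by simp
  ultimately show ?thesis
    using inj by (simp add: bij_betw_def card_subset_eq)
qed

text \<open>Expose the first entry: an entry of rank r has exactly r smaller entries behind it,
  whatever their order, and the ranks run once through 0, ..., card A - 1. Lists over an arbitrary
  finite set are used because removing an entry then requires no renumbering.\<close>

lemma sum_power_list_inversions:
  fixes q :: "'b::comm_semiring_1" and A :: "'a::linorder set"
  assumes "finite A"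
  shows "(\<Sum>xs\<in>permutations_of_set A. q ^ list_inversions xs) = (\<Prod>k<card A. \<Sum>j\<le>k. q ^ j)"
  using assms
proof (induction "card A" arbitrary: A)
  case (Suc n)
  then have ne: "A \<noteq> {}" by auto
  have "(\<Sum>xs\<in>permutations_of_set A. q ^ list_inversions xs) =
     (\<Sum>x\<in>A. \<Sum>xs\<in>(#) x ` permutations_of_set (A - {x}). q ^ list_inversions xs)"
    unfolding permutations_of_set_nonempty[OF ne] using Suc.prems by (intro sum.UNION_disjoint) auto
  also have "\<dots> = (\<Sum>x\<in>A. q ^ card {y\<in>A. y < x} * (\<Prod>k<n. \<Sum>j\<le>k. q ^ j))"
  proof (rule sum.cong[OF refl])
    fix x assume x: "x \<in> A"
    have "(\<Sum>xs\<in>(#) x ` permutations_of_set (A - {x}). q ^ list_inversions xs) =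
        (\<Sum>xs\<in>permutations_of_set (A - {x}). q ^ card {y\<in>A. y < x} * q ^ list_inversions xs)"
    proof (subst sum.reindex, simp, rule sum.cong[OF refl])
      fix xs assume "xs \<in> permutations_of_set (A - {x})"
      then have xs: "distinct xs" "set xs = A - {x}" by (auto dest: permutations_of_setD)
      have "{y. y < x} \<inter> (A - {x}) = {y\<in>A. y < x}" by auto
      then show "((\<lambda>xs. q ^ list_inversions xs) \<circ> (#) x) xs = q ^ card {y\<in>A. y < x} * q ^ list_inversions xs"
        by (simp add: distinct_length_filter[OF xs(1)] xs(2) power_add)
    qed
    also have "\<dots> = q ^ card {y\<in>A. y < x} * (\<Prod>k<n. \<Sum>j\<le>k. q ^ j)"
      using Suc.hyps(1)[of "A - {x}"] Suc.prems x
      by (simp add: sum_distrib_left[symmetric] flip: Suc.hyps(2))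
    finally show "(\<Sum>xs\<in>(#) x ` permutations_of_set (A - {x}). q ^ list_inversions xs) = \<dots>" .
  qed
  also have "\<dots> = (\<Sum>x\<in>A. q ^ card {y\<in>A. y < x}) * (\<Prod>k<n. \<Sum>j\<le>k. q ^ j)"
    by (simp add: sum_distrib_right)
  also have "(\<Sum>x\<in>A. q ^ card {y\<in>A. y < x}) = (\<Sum>j\<in>{..<card A}. q ^ j)"
    by (rule sum.reindex_bij_betw[OF bij_betw_rank[OF Suc.prems]])
  finally show ?case
    by (simp add: mult.commute flip: Suc.hyps(2) lessThan_Suc_atMost)
qed simp

lemma finite_perms: "finite (perms n)"
  by (simp add: perms_def finite_permutations)

lemma bij_betw_perms_lists:
  "bij_betw (\<lambda>\<pi>. map \<pi> [1..<Suc n]) (perms n) (permutations_of_set {1..n})"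
proof -
  let ?h = "\<lambda>\<pi>. map \<pi> [1..<Suc n]"
  have inj: "inj_on ?h (perms n)"
  proof (rule inj_onI, rule ext)
    fix \<sigma> \<tau> i assume *: "\<sigma> \<in> perms n" "\<tau> \<in> perms n" "?h \<sigma> = ?h \<tau>"
    then have "\<forall>i\<in>{1..n}. \<sigma> i = \<tau> i" by (auto simp del: upt_Suc)
    with * show "\<sigma> i = \<tau> i"
      by (cases "i \<in> {1..n}") (auto simp: perms_def permutes_not_in)
  qed
  have sub: "?h ` perms n \<subseteq> permutations_of_set {1..n}"
  proof (intro subsetI)
    fix xs assume "xs \<in> ?h ` perms n"
    then obtain \<pi> where \<pi>: "\<pi> permutes {1..n}" "xs = ?h \<pi>" by (auto simp: perms_def)
    have "set xs = \<pi> ` {1..n}" using \<pi>(2) by (auto simp del: upt_Suc)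
    then show "xs \<in> permutations_of_set {1..n}"
      using \<pi> permutes_inj_on[OF \<pi>(1)] permutes_image[OF \<pi>(1)]
      by (intro permutations_of_setI) (auto simp: distinct_map simp del: upt_Suc)
  qed
  \<comment> \<open>Surjectivity by counting: both sides have n! elements.\<close>
  have "card (?h ` perms n) = card (permutations_of_set {1..n})"
    unfolding card_image[OF inj] by (simp add: perms_def card_permutations)
  then show ?thesis
    using inj sub by (simp add: bij_betw_def card_subset_eq del: upt_Suc)
qed

lemma inv_count_eq_list_inversions: "inv_count n \<pi> = list_inversions (map \<pi> [1..<Suc n])"
proof -
  have "{(i, j). i \<in> {1..n} \<and> j \<in> {1..n} \<and> i < j \<and> \<pi> i > \<pi> j} =
    map_prod Suc Suc ` {(i, j). i < j \<and> j < n \<and> \<pi> (Suc j) < \<pi> (Suc i)}" (is "?A = ?g ` ?B")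
  proof (intro equalityI subsetI)
    fix a assume "a \<in> ?A"
    then obtain i j where a: "a = (i, j)" "i \<ge> 1" "j \<le> n" "i < j" "\<pi> i > \<pi> j" by auto
    then have "(i - 1, j - 1) \<in> ?B" "a = ?g (i - 1, j - 1)" by auto
    then show "a \<in> ?g ` ?B" by blast
  qed auto
  then have "inv_count n \<pi> = card ?B"
    unfolding inv_count_def by (simp add: card_image inj_on_def)
  then show ?thesis
    unfolding list_inversions_eq_card by (simp del: upt_Suc cong: conj_cong)
qed

lemma sum_power_inv_count:
  fixes q :: "'b::comm_semiring_1"
  shows "(\<Sum>\<pi>\<in>perms n. q ^ inv_count n \<pi>) = (\<Prod>k<n. \<Sum>j\<le>k. q ^ j)"
  unfolding inv_count_eq_list_inversions
  using sum.reindex_bij_betw[OF bij_betw_perms_lists, of "\<lambda>xs. q ^ list_inversions xs" n]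
    sum_power_list_inversions[of "{1..n}" q] by simp

section \<open>Decomposition into indecomposable blocks\<close>

definition direct_sum :: "nat \<Rightarrow> (nat \<Rightarrow> nat) \<Rightarrow> (nat \<Rightarrow> nat) \<Rightarrow> nat \<Rightarrow> nat" where
  "direct_sum k \<sigma> \<tau> = (\<lambda>i. if i \<le> k then \<sigma> i else \<tau> (i - k) + k)"

text \<open>Also called connected permutations. The condition \<open>0 < n\<close> excludes the
  empty permutation, so that every block has positive length and the first block is unique.\<close>

definition indec :: "nat \<Rightarrow> (nat \<Rightarrow> nat) set" where
  "indec n = {\<pi> \<in> perms n. 0 < n \<and> (\<forall>k. 0 < k \<and> k < n \<longrightarrow> \<pi> ` {1..k} \<noteq> {1..k})}"

lemma indec_subset_perms: "indec n \<subseteq> perms n"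
  by (auto simp: indec_def)

lemma finite_indec: "finite (indec n)"
  using finite_subset[OF indec_subset_perms finite_perms] .

lemma perms_range: "\<pi> \<in> perms n \<Longrightarrow> \<pi> i \<in> {1..n} \<longleftrightarrow> i \<in> {1..n}"
  unfolding perms_def mem_Collect_eq by (rule permutes_in_image)

lemma perms_outside: "\<pi> \<in> perms n \<Longrightarrow> i \<notin> {1..n} \<Longrightarrow> \<pi> i = i"
  unfolding perms_def mem_Collect_eq by (rule permutes_not_in)

lemma perms_le: "\<pi> \<in> perms n \<Longrightarrow> i \<le> n \<Longrightarrow> \<pi> i \<le> n"
  using perms_range[of \<pi> n i] perms_outside[of \<pi> n i] by (cases "i \<in> {1..n}") auto

lemma perms_pos: "\<pi> \<in> perms n \<Longrightarrow> 0 < \<pi> i \<longleftrightarrow> 0 < i"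
  using perms_range[of \<pi> n i] perms_outside[of \<pi> n i] by (cases "i \<in> {1..n}") auto

lemma permsI:
  assumes "\<And>i. i \<in> {1..n} \<Longrightarrow> \<pi> i \<in> {1..n}" "inj_on \<pi> {1..n}" "\<And>i. i \<notin> {1..n} \<Longrightarrow> \<pi> i = i"
  shows "\<pi> \<in> perms n"
proof -
  have "\<pi> ` {1..n} = {1..n}" using assms by (intro endo_inj_surj) auto
  then show ?thesis
    unfolding perms_def mem_Collect_eq using assms by (intro bij_imp_permutes) (auto simp: bij_betw_def)
qed

lemma perms_inj: "\<pi> \<in> perms n \<Longrightarrow> inj \<pi>"
  unfolding perms_def mem_Collect_eq by (rule permutes_inj)

lemma direct_sum_perms:
  assumes \<sigma>: "\<sigma> \<in> perms k" and \<tau>: "\<tau> \<in> perms m"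
  shows "direct_sum k \<sigma> \<tau> \<in> perms (k + m)"
proof (rule permsI)
  fix i assume i: "i \<in> {1..k + m}"
  then show "direct_sum k \<sigma> \<tau> i \<in> {1..k + m}"
    using perms_le[OF \<sigma>, of i] perms_pos[OF \<sigma>, of i] perms_le[OF \<tau>, of "i - k"] perms_pos[OF \<tau>, of "i - k"]
    by (auto simp: direct_sum_def)
next
  show "inj_on (direct_sum k \<sigma> \<tau>) {1..k + m}"
  proof (rule inj_onI)
    fix i j assume "i \<in> {1..k + m}" "j \<in> {1..k + m}" "direct_sum k \<sigma> \<tau> i = direct_sum k \<sigma> \<tau> j"
    then show "i = j"
      using perms_le[OF \<sigma>, of i] perms_le[OF \<sigma>, of j] perms_pos[OF \<tau>, of "i - k"] perms_pos[OF \<tau>, of "j - k"]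
        injD[OF perms_inj[OF \<sigma>], of i j] injD[OF perms_inj[OF \<tau>], of "i - k" "j - k"]
      by (auto simp: direct_sum_def split: if_splits)
  qed
next
  fix i assume "i \<notin> {1..k + m}"
  show "direct_sum k \<sigma> \<tau> i = i"
  proof (cases "i = 0")
    case True
    then show ?thesis using perms_outside[OF \<sigma>, of 0] by (simp add: direct_sum_def)
  next
    case False
    then have "k < i" "i - k \<notin> {1..m}" using \<open>i \<notin> {1..k + m}\<close> by auto
    then show ?thesis using perms_outside[OF \<tau>, of "i - k"] by (simp add: direct_sum_def)
  qed
qed

text \<open>No inversion crosses the cut, since positions up to k have values up to k and later
  positions have larger values.\<close>

lemma inv_count_direct_sum:
  assumes \<sigma>: "\<sigma> \<in> perms k" and \<tau>: "\<tau> \<in> perms m"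
  shows "inv_count (k + m) (direct_sum k \<sigma> \<tau>) = inv_count k \<sigma> + inv_count m \<tau>"
proof -
  let ?I = "\<lambda>n \<pi>. {(i, j). i \<in> {1..n} \<and> j \<in> {1..n} \<and> i < j \<and> \<pi> i > \<pi> j}"
  let ?s = "map_prod (\<lambda>i. i + k) (\<lambda>i. i + k)"
  have fin: "finite (?I n \<pi>)" for n and \<pi> :: "nat \<Rightarrow> nat"
    by (rule finite_subset[of _ "{1..n} \<times> {1..n}"]) auto
  have "?I (k + m) (direct_sum k \<sigma> \<tau>) = ?I k \<sigma> \<union> ?s ` ?I m \<tau>"
  proof (intro equalityI subsetI)
    fix a assume "a \<in> ?I (k + m) (direct_sum k \<sigma> \<tau>)"
    then obtain i j where a: "a = (i, j)" "i \<in> {1..k + m}" "j \<in> {1..k + m}" "i < j"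
      "direct_sum k \<sigma> \<tau> i > direct_sum k \<sigma> \<tau> j" by auto
    consider "j \<le> k" | "i \<le> k" "k < j" | "k < i" "k < j" using a(4) by linarith
    then show "a \<in> ?I k \<sigma> \<union> ?s ` ?I m \<tau>"
    proof cases
      case 1 then show ?thesis using a by (auto simp: direct_sum_def)
    next
      case 2 then show ?thesis using a perms_le[OF \<sigma>, of i] by (auto simp: direct_sum_def)
    next
      case 3
      then have "(i - k, j - k) \<in> ?I m \<tau>" "a = ?s (i - k, j - k)" using a by (auto simp: direct_sum_def)
      then show ?thesis by blast
    qed
  qed (auto simp: direct_sum_def)
  moreover have "card (?I k \<sigma> \<union> ?s ` ?I m \<tau>) = card (?I k \<sigma>) + card (?s ` ?I m \<tau>)"
    using fin by (intro card_Un_disjoint) auto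
  moreover have "card (?s ` ?I m \<tau>) = card (?I m \<tau>)"
    by (intro card_image) (auto simp: inj_on_def)
  ultimately show ?thesis unfolding inv_count_def by simp
qed

lemma orbit_direct_sum_left:
  assumes \<sigma>: "\<sigma> \<in> perms k" and x: "x \<le> k"
  shows "orbit (direct_sum k \<sigma> \<tau>) x = orbit \<sigma> x"
  by (rule orbit_cong0[of x "{..k}"]) (use x perms_le[OF \<sigma>] in \<open>auto simp: direct_sum_def\<close>)

text \<open>The shift by k conjugates \<open>\<tau>\<close> to the direct sum above k. Both
  inductions carry positivity along, because the direct sum follows \<open>\<tau>\<close> only at
  positions beyond k.\<close>

lemma orbit_direct_sum_right:
  assumes \<tau>: "\<tau> \<in> perms m" and x: "0 < x"
  shows "orbit (direct_sum k \<sigma> \<tau>) (x + k) = (\<lambda>z. z + k) ` orbit \<tau> x"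
proof (intro equalityI subsetI)
  fix z assume "z \<in> orbit (direct_sum k \<sigma> \<tau>) (x + k)"
  then have "z \<in> (\<lambda>z. z + k) ` orbit \<tau> x \<and> k < z"
    by induction (use x perms_pos[OF \<tau>] in \<open>auto simp: direct_sum_def intro: orbit.intros\<close>)
  then show "z \<in> (\<lambda>z. z + k) ` orbit \<tau> x" ..
next
  fix z assume "z \<in> (\<lambda>z. z + k) ` orbit \<tau> x"
  then obtain z' where z': "z' \<in> orbit \<tau> x" "z = z' + k" by blast
  from z'(1) have "z' + k \<in> orbit (direct_sum k \<sigma> \<tau>) (x + k) \<and> 0 < z'"
  proof induction
    case base
    then show ?case using orbit.base[of "direct_sum k \<sigma> \<tau>" "x + k"] x perms_pos[OF \<tau>, of x] by (simp add: direct_sum_def)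
  next
    case (step z)
    then show ?case using orbit.step[of "z + k" "direct_sum k \<sigma> \<tau>" "x + k"] perms_pos[OF \<tau>, of z] by (simp add: direct_sum_def)
  qed
  then show "z \<in> orbit (direct_sum k \<sigma> \<tau>) (x + k)" using z' by simp
qed

lemma orbit_perms_subset:
  assumes \<pi>: "\<pi> \<in> perms n" and x: "x \<in> {1..n}"
  shows "orbit \<pi> x \<subseteq> {1..n}"
proof
  fix z assume "z \<in> orbit \<pi> x"
  then show "z \<in> {1..n}"
    by induction (use x perms_range[OF \<pi>] in blast)+
qed

lemma cycle_count_direct_sum:
  assumes \<sigma>: "\<sigma> \<in> perms k" and \<tau>: "\<tau> \<in> perms m"
  shows "cycle_count (k + m) i (direct_sum k \<sigma> \<tau>) = cycle_count k i \<sigma> + cycle_count m i \<tau>"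
proof -
  let ?C = "\<lambda>n \<pi>. {orbit \<pi> x | x. x \<in> {1..n} \<and> card (orbit \<pi> x) = i}"
  let ?s = "\<lambda>X. (\<lambda>z. z + k) ` X"
  have fin: "finite (?C n \<pi>)" for n :: nat and \<pi> :: "nat \<Rightarrow> nat"
    by (rule finite_subset[of _ "orbit \<pi> ` {1..n}"]) auto
  have ci: "card (?s X) = card X" for X :: "nat set" by (intro card_image) (auto simp: inj_on_def)
  have eq: "?C (k + m) (direct_sum k \<sigma> \<tau>) = ?C k \<sigma> \<union> ?s ` ?C m \<tau>"
  proof (intro equalityI subsetI)
    fix X assume "X \<in> ?C (k + m) (direct_sum k \<sigma> \<tau>)"
    then obtain x where x: "X = orbit (direct_sum k \<sigma> \<tau>) x" "x \<in> {1..k + m}" "card X = i" by auto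
    show "X \<in> ?C k \<sigma> \<union> ?s ` ?C m \<tau>"
    proof (cases "x \<le> k")
      case True
      then show ?thesis using x orbit_direct_sum_left[OF \<sigma> True, of \<tau>] by auto
    next
      case False
      then have *: "X = ?s (orbit \<tau> (x - k))" using x orbit_direct_sum_right[OF \<tau>, of "x - k" k \<sigma>] by simp
      moreover have "x - k \<in> {1..m}" "card (orbit \<tau> (x - k)) = i"
        using x False ci[of "orbit \<tau> (x - k)"] * by auto
      then have "orbit \<tau> (x - k) \<in> ?C m \<tau>" by blast
      ultimately show ?thesis by blast
    qed
  next
    fix X assume "X \<in> ?C k \<sigma> \<union> ?s ` ?C m \<tau>"
    then show "X \<in> ?C (k + m) (direct_sum k \<sigma> \<tau>)"
    proof
      assume "X \<in> ?C k \<sigma>"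
      then obtain x where "X = orbit \<sigma> x" "x \<in> {1..k}" "card X = i" by auto
      then show ?thesis using orbit_direct_sum_left[OF \<sigma>, of x \<tau>] by (auto intro!: exI[of _ x])
    next
      assume "X \<in> ?s ` ?C m \<tau>"
      then obtain x where "X = ?s (orbit \<tau> x)" "x \<in> {1..m}" "card (orbit \<tau> x) = i" by auto
      then show ?thesis using orbit_direct_sum_right[OF \<tau>, of x k \<sigma>] ci by (auto intro!: exI[of _ "x + k"])
    qed
  qed
  have "?C k \<sigma> \<inter> ?s ` ?C m \<tau> = {}"
  proof (rule ccontr)
    assume "?C k \<sigma> \<inter> ?s ` ?C m \<tau> \<noteq> {}"
    then obtain x x' where x: "x \<in> {1..k}" "x' \<in> {1..m}" "orbit \<sigma> x = ?s (orbit \<tau> x')" by auto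
    \<comment> \<open>Orbits are nonempty, so one inside {1..k} cannot equal one that lies above
      k.\<close>
    have "\<sigma> x \<in> orbit \<sigma> x" by (rule orbit.base)
    then show False using x orbit_perms_subset[OF \<sigma>, of x] orbit_perms_subset[OF \<tau>, of x'] by fastforce
  qed
  then have "card (?C (k + m) (direct_sum k \<sigma> \<tau>)) = card (?C k \<sigma>) + card (?s ` ?C m \<tau>)"
    unfolding eq using fin by (intro card_Un_disjoint) auto
  also have "card (?s ` ?C m \<tau>) = card (?C m \<tau>)"
    by (intro card_image) (auto simp: inj_on_def inj_image_eq_iff inj_def)
  finally show ?thesis by (simp add: cycle_count_def)
qed

lemma cycle_count_le: "cycle_count n i \<pi> \<le> n"
proof -
  have "cycle_count n i \<pi> \<le> card (orbit \<pi> ` {1..n})"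
    unfolding cycle_count_def by (intro card_mono) auto
  also have "\<dots> \<le> n" using card_image_le[of "{1..n}" "orbit \<pi>"] by simp
  finally show ?thesis .
qed

text \<open>The first block ends at the least positive k whose initial segment is invariant, and
  minimality makes it indecomposable. Two different cuts are impossible: the shorter block would be
  an invariant proper initial segment of the longer one.\<close>

lemma bij_betw_direct_sum:
  assumes "0 < n"
  shows "bij_betw (\<lambda>(k, \<sigma>, \<tau>). direct_sum k \<sigma> \<tau>) (SIGMA k:{..n}. indec k \<times> perms (n - k)) (perms n)"
  unfolding bij_betw_def
proof
  have no_split: False
    if "k < k'" "\<sigma> \<in> perms k" "\<sigma>' \<in> indec k'" "direct_sum k \<sigma> \<tau> = direct_sum k' \<sigma>' \<tau>'" "0 < k" for k k' \<sigma> \<sigma>' \<tau> \<tau>'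
  proof -
    have "\<sigma>' i = \<sigma> i" if "i \<le> k" for i
      using fun_cong[OF \<open>direct_sum k \<sigma> \<tau> = direct_sum k' \<sigma>' \<tau>'\<close>, of i] that \<open>k < k'\<close> by (simp add: direct_sum_def)
    then have "\<sigma>' ` {1..k} = \<sigma> ` {1..k}" by (intro image_cong) auto
    also have "\<dots> = {1..k}" using that(2) by (simp add: perms_def permutes_image)
    finally show False using that by (auto simp: indec_def)
  qed
  show "inj_on (\<lambda>(k, \<sigma>, \<tau>). direct_sum k \<sigma> \<tau>) (SIGMA k:{..n}. indec k \<times> perms (n - k))"
  proof (rule inj_onI)
    fix a b assume a: "a \<in> (SIGMA k:{..n}. indec k \<times> perms (n - k))"
      and b: "b \<in> (SIGMA k:{..n}. indec k \<times> perms (n - k))"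
      and ab: "(\<lambda>(k, \<sigma>, \<tau>). direct_sum k \<sigma> \<tau>) a = (\<lambda>(k, \<sigma>, \<tau>). direct_sum k \<sigma> \<tau>) b"
    obtain k \<sigma> \<tau> k' \<sigma>' \<tau>' where [simp]: "a = (k, \<sigma>, \<tau>)" "b = (k', \<sigma>', \<tau>')" by (cases a, cases b)
    have A: "k \<le> n" "\<sigma> \<in> indec k" "\<tau> \<in> perms (n - k)" "k' \<le> n" "\<sigma>' \<in> indec k'" "\<tau>' \<in> perms (n - k')"
      and eq: "direct_sum k \<sigma> \<tau> = direct_sum k' \<sigma>' \<tau>'" using a b ab by auto
    have pos: "0 < k" "0 < k'" using A by (auto simp: indec_def)
    have P: "\<sigma> \<in> perms k" "\<sigma>' \<in> perms k'" using A by (auto simp: indec_def)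
    have kk: "k = k'"
      using no_split[of k k' \<sigma> \<sigma>' \<tau> \<tau>'] no_split[of k' k \<sigma>' \<sigma> \<tau>' \<tau>] A P pos eq
      by (metis linorder_neqE_nat)
    have "\<sigma> i = \<sigma>' i" for i
      using fun_cong[OF eq, of i] perms_outside[OF P(1), of i] perms_outside[OF P(2), of i] kk
      by (cases "i \<le> k") (auto simp: direct_sum_def)
    moreover have "\<tau> i = \<tau>' i" for i
      using fun_cong[OF eq, of "i + k"] perms_outside[OF A(3), of i] perms_outside[OF A(6), of i] kk
      by (cases "i = 0") (auto simp: direct_sum_def)
    ultimately show "a = b" using kk by auto
  qed
  show "(\<lambda>(k, \<sigma>, \<tau>). direct_sum k \<sigma> \<tau>) ` (SIGMA k:{..n}. indec k \<times> perms (n - k)) = perms n"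
  proof (intro equalityI subsetI)
    fix \<pi> assume "\<pi> \<in> (\<lambda>(k, \<sigma>, \<tau>). direct_sum k \<sigma> \<tau>) ` (SIGMA k:{..n}. indec k \<times> perms (n - k))"
    then obtain k \<sigma> \<tau> where "k \<le> n" "\<sigma> \<in> indec k" "\<tau> \<in> perms (n - k)" "\<pi> = direct_sum k \<sigma> \<tau>" by auto
    then show "\<pi> \<in> perms n"
      using direct_sum_perms[of \<sigma> k \<tau> "n - k"] by (auto simp: indec_def)
  next
    fix \<pi> assume \<pi>: "\<pi> \<in> perms n"
    define Q where "Q k \<longleftrightarrow> 0 < k \<and> \<pi> ` {1..k} = {1..k}" for k
    define k where "k = (LEAST k. Q k)"
    have Qn: "Q n" using \<pi> assms by (simp add: Q_def perms_def permutes_image)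
    have Qk: "Q k" unfolding k_def using Qn by (rule LeastI)
    have kn: "k \<le> n" unfolding k_def using Qn by (rule Least_le)
    have min: "\<not> Q j" if "j < k" for j using that unfolding k_def by (rule not_less_Least)
    have img: "\<pi> ` {1..k} = {1..k}" and k0: "0 < k" using Qk by (auto simp: Q_def)
    \<comment> \<open>All values in {1..k} are already taken by positions in {1..k}, so injectivity
      keeps later positions above k.\<close>
    have above: "k < \<pi> i" if "k < i" for i
    proof (rule ccontr)
      assume "\<not> k < \<pi> i"
      then have "\<pi> i \<in> \<pi> ` {1..k}" unfolding img using perms_pos[OF \<pi>, of i] that by auto
      then show False using that injD[OF perms_inj[OF \<pi>]] by fastforce
    qed
    define \<sigma> where "\<sigma> = (\<lambda>i. if i \<le> k then \<pi> i else i)"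
    define \<tau> where "\<tau> = (\<lambda>i. if i = 0 then 0 else \<pi> (i + k) - k)"
    have \<sigma>: "\<sigma> \<in> indec k"
    proof -
      have "\<sigma> \<in> perms k"
      proof (rule permsI)
        fix i assume "i \<in> {1..k}"
        then show "\<sigma> i \<in> {1..k}" using img by (auto simp: \<sigma>_def)
      next
        show "inj_on \<sigma> {1..k}"
          using perms_inj[OF \<pi>] by (auto simp: inj_on_def \<sigma>_def inj_def)
      next
        fix i assume "i \<notin> {1..k}"
        then show "\<sigma> i = i" using perms_outside[OF \<pi>, of 0] by (auto simp: \<sigma>_def not_less_eq_eq)
      qed
      moreover have "\<sigma> ` {1..j} \<noteq> {1..j}" if "0 < j" "j < k" for j
      proof -
        have "\<sigma> ` {1..j} = \<pi> ` {1..j}" using that by (intro image_cong) (auto simp: \<sigma>_def)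
        then show ?thesis using min[OF that(2)] that by (simp add: Q_def)
      qed
      ultimately show ?thesis using k0 by (simp add: indec_def)
    qed
    have \<tau>: "\<tau> \<in> perms (n - k)"
    proof (rule permsI)
      fix i assume "i \<in> {1..n - k}"
      then have "0 < i" "i + k \<le> n" by auto
      then show "\<tau> i \<in> {1..n - k}"
        using above[of "i + k"] perms_le[OF \<pi>, of "i + k"] by (auto simp: \<tau>_def)
    next
      show "inj_on \<tau> {1..n - k}"
      proof (rule inj_onI)
        fix i j assume "i \<in> {1..n - k}" "j \<in> {1..n - k}" "\<tau> i = \<tau> j"
        then show "i = j"
          using above[of "i + k"] above[of "j + k"] injD[OF perms_inj[OF \<pi>], of "i + k" "j + k"]
          by (auto simp: \<tau>_def)
      qed
    next
      fix i assume "i \<notin> {1..n - k}"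
      then show "\<tau> i = i" using perms_outside[OF \<pi>, of "i + k"] kn by (auto simp: \<tau>_def)
    qed
    have "direct_sum k \<sigma> \<tau> = \<pi>"
    proof
      fix i show "direct_sum k \<sigma> \<tau> i = \<pi> i"
        using above[of i] by (auto simp: direct_sum_def \<sigma>_def \<tau>_def)
    qed
    moreover have "(k, \<sigma>, \<tau>) \<in> (SIGMA k:{..n}. indec k \<times> perms (n - k))" using \<sigma> \<tau> kn by auto
    ultimately show "\<pi> \<in> (\<lambda>(k, \<sigma>, \<tau>). direct_sum k \<sigma> \<tau>) ` (SIGMA k:{..n}. indec k \<times> perms (n - k))"
      by force
  qed
qed

lemma sum_perms_direct_sum:
  assumes "0 < n"
  shows "(\<Sum>\<pi>\<in>perms n. F \<pi>) = (\<Sum>k\<le>n. \<Sum>\<sigma>\<in>indec k. \<Sum>\<tau>\<in>perms (n - k). F (direct_sum k \<sigma> \<tau>))"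
proof -
  have "(\<Sum>\<pi>\<in>perms n. F \<pi>) = (\<Sum>(k, \<sigma>, \<tau>)\<in>(SIGMA k:{..n}. indec k \<times> perms (n - k)). F (direct_sum k \<sigma> \<tau>))"
    using sum.reindex_bij_betw[OF bij_betw_direct_sum[OF assms], of F] by (simp add: case_prod_unfold)
  also have "\<dots> = (\<Sum>k\<le>n. \<Sum>(\<sigma>, \<tau>)\<in>indec k \<times> perms (n - k). F (direct_sum k \<sigma> \<tau>))"
    by (subst sum.Sigma) (auto simp: finite_indec finite_perms)
  also have "\<dots> = (\<Sum>k\<le>n. \<Sum>\<sigma>\<in>indec k. \<Sum>\<tau>\<in>perms (n - k). F (direct_sum k \<sigma> \<tau>))"
    by (simp add: sum.cartesian_product)
  finally show ?thesis .
qed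

text \<open>The cycle 1 -> 2 -> ... -> n -> 1: an indecomposable block that consists of a single
  n-cycle. It witnesses that blocks containing an n-cycle have positive weight, whence the
  positivity of the constants m_n.\<close>

definition rot :: "nat \<Rightarrow> nat \<Rightarrow> nat" where
  "rot n = (\<lambda>i. if i \<in> {1..<n} then Suc i else if i = n then 1 else i)"

lemma rot_indec:
  assumes "1 \<le> n"
  shows "rot n \<in> indec n"
proof -
  have "rot n \<in> perms n"
    by (rule permsI) (use assms in \<open>auto simp: rot_def inj_on_def split: if_splits\<close>)
  moreover have "rot n ` {1..k} \<noteq> {1..k}" if "0 < k" "k < n" for k
  proof
    assume "rot n ` {1..k} = {1..k}"
    moreover have "rot n k \<in> rot n ` {1..k}" using that by auto
    ultimately show False using that by (auto simp: rot_def)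
  qed
  ultimately show ?thesis using assms by (simp add: indec_def)
qed

lemma cycle_count_rot:
  assumes "1 \<le> n"
  shows "1 \<le> cycle_count n n (rot n)"
proof -
  have sub: "orbit (rot n) 1 \<subseteq> {1..n}"
    using orbit_perms_subset[of "rot n" n 1] rot_indec[OF assms] assms by (auto simp: indec_def)
  have "i \<in> orbit (rot n) 1" if "2 \<le> i" "i \<le> n" for i
    using that
  proof (induction i rule: dec_induct)
    case base
    then show ?case using orbit.base[of "rot n" 1] by (simp add: rot_def numeral_2_eq_2)
  next
    case (step i)
    then show ?case using orbit.step[of i "rot n" 1] by (simp add: rot_def)
  qed
  moreover have "1 \<in> orbit (rot n) 1"
  proof (cases "n = 1")
    case True
    then show ?thesis using orbit.base[of "rot n" 1] by (simp add: rot_def)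
  next
    case False
    then show ?thesis using calculation[of n] assms orbit.step[of n "rot n" 1] by (simp add: rot_def)
  qed
  ultimately have "{1..n} \<subseteq> orbit (rot n) 1"
    by (metis atLeastAtMost_iff le_antisym not_less_eq_eq one_add_one plus_1_eq_Suc subsetI)
  then have "orbit (rot n) 1 = {1..n}" using sub by auto
  then have "{1..n} \<in> {orbit (rot n) x | x. x \<in> {1..n} \<and> card (orbit (rot n) x) = n}"
    using assms by force
  moreover have "finite {orbit (rot n) x | x. x \<in> {1..n} \<and> card (orbit (rot n) x) = n}"
    by (rule finite_subset[of _ "orbit (rot n) ` {1..n}"]) auto
  ultimately have "0 < cycle_count n n (rot n)"
    unfolding cycle_count_def card_gt_0_iff by blast
  then show ?thesis by simp
qed

section \<open>Convergence in distribution of random vectors\<close>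

text \<open>Linear combinations of characters in the coordinates from \<open>I\<close>. Their
  expectations are determined by the characteristic function, and they are closed under products, as
  Stone-Weierstrass demands.\<close>

inductive_set trig_polys :: "'i set \<Rightarrow> (('i \<Rightarrow> real) \<Rightarrow> complex) set" for I where
  monomial: "(\<lambda>x. c * cis (\<Sum>i\<in>I. \<theta> i * x i)) \<in> trig_polys I"
| add: "g \<in> trig_polys I \<Longrightarrow> h \<in> trig_polys I \<Longrightarrow> (\<lambda>x. g x + h x) \<in> trig_polys I"

lemma trig_polys_const: "(\<lambda>_. c) \<in> trig_polys I"
  using monomial[of c "\<lambda>_. 0" I] by simp

lemma trig_polys_mult:
  assumes "g \<in> trig_polys I" "h \<in> trig_polys I"
  shows "(\<lambda>x. g x * h x) \<in> trig_polys I"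
  using assms(1)
proof induction
  case (monomial c \<theta>)
  show ?case using assms(2)
  proof induction
    case (monomial d \<eta>)
    have "(\<lambda>x. c * cis (\<Sum>i\<in>I. \<theta> i * x i) * (d * cis (\<Sum>i\<in>I. \<eta> i * x i))) =
       (\<lambda>x. (c * d) * cis (\<Sum>i\<in>I. (\<theta> i + \<eta> i) * x i))"
      by (simp add: cis_mult distrib_left distrib_right sum.distrib mult_ac add.commute)
    then show ?case using trig_polys.monomial[of "c * d" "\<lambda>i. \<theta> i + \<eta> i" I] by simp
  qed (simp add: trig_polys.add distrib_left)
qed (simp add: trig_polys.add distrib_right)

lemma trig_polys_sin:
  assumes "finite I" "i \<in> I"
  shows "(\<lambda>x. of_real (sin (a * x i))) \<in> trig_polys I"
proof -
  have *: "(\<Sum>j\<in>I. (if j = i then b else 0) * x j) = b * x i" for b and x :: "'a \<Rightarrow> real"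
  proof -
    have "(\<Sum>j\<in>I. (if j = i then b else 0) * x j) = (\<Sum>j\<in>I. if j = i then b * x j else 0)"
      by (rule sum.cong) auto
    then show ?thesis using assms by simp
  qed
  have sin_eq: "(\<lambda>x. of_real (sin (a * x i))) =
      (\<lambda>x. (- \<i> / 2) * cis (\<Sum>j\<in>I. (if j = i then a else 0) * x j)
         + (\<i> / 2) * cis (\<Sum>j\<in>I. (if j = i then - a else 0) * x j))"
    unfolding * by (auto simp: complex_eq_iff)
  show ?thesis
    unfolding sin_eq by (rule trig_polys.add; rule trig_polys.monomial)
qed

lemma trig_polys_continuous: "g \<in> trig_polys I \<Longrightarrow> continuous_on UNIV g"
proof (induction rule: trig_polys.induct)
  case (monomial c \<theta>)
  show ?case
    unfolding cis_conv_exp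
    by (intro continuous_intros continuous_on_product_coordinates)
qed (intro continuous_intros)

lemma trig_polys_bounded: "g \<in> trig_polys I \<Longrightarrow> \<exists>B. \<forall>x. norm (g x) \<le> B"
proof (induction rule: trig_polys.induct)
  case (monomial c \<theta>)
  show ?case by (rule exI[of _ "norm c"]) (simp add: norm_mult)
next
  case (add g h)
  then obtain B C where "\<forall>x. norm (g x) \<le> B" "\<forall>x. norm (h x) \<le> C" by blast
  then show ?case by (intro exI[of _ "B + C"]) (auto intro: order_trans[OF norm_triangle_ineq] add_mono)
qed

lemma borel_measurable_trig_polys:
  fixes g :: "('i::countable \<Rightarrow> real) \<Rightarrow> complex"
  assumes "g \<in> trig_polys I"
  shows "g \<in> borel_measurable borel"
  using trig_polys_continuous[OF assms] by (rule borel_measurable_continuous_onI)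

text \<open>Tychonoff's theorem. The index type may be infinite; coordinates outside a finite set of
  interest are pinned by taking equal bounds.\<close>

lemma compact_cube:
  fixes a b :: "'i \<Rightarrow> real"
  shows "compact {x. \<forall>i. a i \<le> x i \<and> x i \<le> b i}"
proof -
  have "{x. \<forall>i. a i \<le> x i \<and> x i \<le> b i} = (\<Pi>\<^sub>E i\<in>UNIV. {a i..b i})"
    by auto
  moreover have "compactin (product_topology (\<lambda>i. euclidean) UNIV) (\<Pi>\<^sub>E i\<in>UNIV. {a i..b i})"
    unfolding compactin_PiE by (auto simp: compactin_euclidean_iff)
  ultimately show ?thesis by (simp add: euclidean_product_topology)
qed

text \<open>Composing \<open>f\<close> with the triangle wave \<open>arcsin (sin (a t)) / a\<close> in each coordinate makes it
  periodic without changing it on the cube, so that the approximation is uniform on the whole space.\<close>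

lemma trig_polys_dense:
  fixes f :: "('i::countable \<Rightarrow> real) \<Rightarrow> real"
  assumes I: "finite I" and f: "continuous_on UNIV f" and B: "\<And>x. \<bar>f x\<bar> \<le> B"
    and K: "0 < K" and \<epsilon>: "0 < \<epsilon>"
  obtains g where "g \<in> trig_polys I"
    and "\<And>x. (\<forall>i\<in>I. \<bar>x i\<bar> \<le> K) \<Longrightarrow> (\<forall>i. i \<notin> I \<longrightarrow> x i = 0) \<Longrightarrow> \<bar>f x - Re (g x)\<bar> \<le> \<epsilon>"
    and "\<And>x. \<bar>Re (g x)\<bar> \<le> B + \<epsilon>"
proof -
  \<comment> \<open>A quarter period: a K = pi / 2, so \<open>arcsin\<close> inverts the sine on the
    whole interval from -K to K.\<close>
  define a where "a = pi / (2 * K)"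
  have a: "0 < a" using K by (simp add: a_def)
  define S :: "('i \<Rightarrow> real) set" where
    "S = {y. \<forall>i. (if i \<in> I then -1 else 0) \<le> y i \<and> y i \<le> (if i \<in> I then 1 else 0)}"
  define F where "F y = f (\<lambda>i. arcsin (y i) / a)" for y :: "'i \<Rightarrow> real"
  define \<Phi> :: "('i \<Rightarrow> real) \<Rightarrow> 'i \<Rightarrow> real" where "\<Phi> x = (\<lambda>i. if i \<in> I then sin (a * x i) else 0)" for x
  \<comment> \<open>Stone-Weierstrass is applied on the compact cube \<open>S\<close> in the
    variables y = sin (a x). The admissible functions are those whose pullback along
    \<open>\<Phi>\<close> is a trigonometric polynomial; the coordinates y i belong to them and
    separate points.\<close>
  define P where "P G \<longleftrightarrow> continuous_on S G \<and> (\<exists>g\<in>trig_polys I. \<forall>x. of_real (G (\<Phi> x)) = g x)"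
    for G :: "('i \<Rightarrow> real) \<Rightarrow> real"
  have \<Phi>: "\<Phi> x \<in> S" for x by (auto simp: S_def \<Phi>_def)
  have coord: "continuous_on S (\<lambda>y. y i)" for i
    by (rule continuous_on_subset[OF continuous_on_product_coordinates]) simp
  have yS: "- 1 \<le> y i \<and> y i \<le> 1" if "y \<in> S" for y i
    using that by (auto simp: S_def dest: spec[of _ i] split: if_splits)
  have contF: "continuous_on S F"
    unfolding F_def
  proof (rule continuous_on_compose2[OF f])
    show "continuous_on S (\<lambda>y i. arcsin (y i) / a)"
      using yS a by (intro continuous_on_coordinatewise_then_product continuous_intros coord) auto
  qed simp
  have "\<exists>G. P G \<and> (\<forall>y\<in>S. \<bar>F y - G y\<bar> < \<epsilon>)"
  proof (rule Stone_Weierstrass_HOL[of S P])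
    show "compact S" unfolding S_def by (rule compact_cube)
    show "P (\<lambda>x. c)" for c
      using trig_polys_const[of "of_real c" I] by (auto simp: P_def)
    show "P G \<Longrightarrow> continuous_on S G" for G by (simp add: P_def)
    show "P (\<lambda>x. G x + H x)" if "P G \<and> P H" for G H
      using that trig_polys.add[of _ I] unfolding P_def
      by (auto intro!: continuous_intros)
    show "P (\<lambda>x. G x * H x)" if "P G \<and> P H" for G H
      using that trig_polys_mult[of _ I] unfolding P_def
      by (auto intro!: continuous_intros)
    show "\<exists>G. P G \<and> G y \<noteq> G z" if yz: "y \<in> S \<and> z \<in> S \<and> y \<noteq> z" for y z
    proof -
      obtain i where i: "y i \<noteq> z i" using yz by auto
      have "i \<in> I"
      proof (rule ccontr)
        assume "i \<notin> I"
        then have "y i = 0" "z i = 0" using yz by (auto simp: S_def dest!: spec[of _ i])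
        then show False using i by simp
      qed
      then have "P (\<lambda>y. y i)"
        using trig_polys_sin[OF I, of i a] coord[of i] by (auto simp: P_def \<Phi>_def)
      then show ?thesis using i by blast
    qed
  qed (use contF \<epsilon> in auto)
  then obtain G g where G: "\<forall>y\<in>S. \<bar>F y - G y\<bar> < \<epsilon>" and g: "g \<in> trig_polys I"
    and Gg: "\<And>x. of_real (G (\<Phi> x)) = g x" unfolding P_def by blast
  have Re: "Re (g x) = G (\<Phi> x)" for x using Gg[of x, symmetric] by simp
  show ?thesis
  proof (rule that[OF g])
    fix x assume x: "\<forall>i\<in>I. \<bar>x i\<bar> \<le> K" "\<forall>i. i \<notin> I \<longrightarrow> x i = 0"
    have "arcsin (\<Phi> x i) / a = x i" for i
    proof (cases "i \<in> I")
      case True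
      then have "\<bar>a * x i\<bar> \<le> a * K" using x a by (auto simp: abs_mult intro!: mult_left_mono)
      also have "a * K = pi / 2" using K by (simp add: a_def)
      finally have "arcsin (sin (a * x i)) = a * x i" by (intro arcsin_sin) auto
      then show ?thesis using True a by (simp add: \<Phi>_def)
    qed (use x in \<open>simp add: \<Phi>_def\<close>)
    then have "F (\<Phi> x) = f x" by (simp add: F_def)
    then show "\<bar>f x - Re (g x)\<bar> \<le> \<epsilon>" using bspec[OF G \<Phi>[of x]] Re[of x] by simp
  next
    fix x
    show "\<bar>Re (g x)\<bar> \<le> B + \<epsilon>"
      using bspec[OF G \<Phi>[of x]] B[of "\<lambda>i. arcsin (\<Phi> x i) / a"] unfolding Re F_def by linarith
  qed
qed

text \<open>A continuous stand-in for the indicator of large values: 0 up to K, 1 from K + 1 on.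
  Continuity lets its integrals converge along weakly convergent marginals.\<close>

definition ramp :: "real \<Rightarrow> real \<Rightarrow> real" where
  "ramp K t = min 1 (max 0 (\<bar>t\<bar> - K))"

lemma ramp_bounds: "0 \<le> ramp K t" "ramp K t \<le> 1" "\<bar>ramp K t\<bar> \<le> 1"
  by (auto simp: ramp_def)

lemma isCont_ramp: "isCont (ramp K) t"
  unfolding ramp_def by (intro continuous_intros)

lemma borel_measurable_ramp [measurable]: "ramp K \<in> borel_measurable borel"
  unfolding ramp_def by measurable

lemma borel_measurable_coordinate [measurable]:
  "(\<lambda>x. x i) \<in> borel_measurable (borel :: ('i::countable \<Rightarrow> real) measure)"
  by (rule borel_measurable_continuous_onI) (rule continuous_on_product_coordinates)

text \<open>A random vector indexed by \<open>I\<close> lives on the full function space;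
  \<open>support\<close> sets the other coordinates to 0, so test functions have to be approximated
  only at points vanishing off \<open>I\<close>.\<close>

locale rvec_measure = prob_space M for M :: "('i::countable \<Rightarrow> real) measure" +
  fixes I :: "'i set"
  assumes sets_M [simp, measurable_cong]: "sets M = sets borel"
    and support: "AE x in M. \<forall>i. i \<notin> I \<longrightarrow> x i = 0"
    and finite_I: "finite I"
begin

definition chf :: "('i \<Rightarrow> real) \<Rightarrow> complex" where
  "chf \<theta> = (\<integral>x. cis (\<Sum>i\<in>I. \<theta> i * x i) \<partial>M)"

lemma integrable_trig: "g \<in> trig_polys I \<Longrightarrow> integrable M g"
  using trig_polys_bounded[of g I] borel_measurable_trig_polys[of g I]
  by (auto intro!: integrable_const_bound)

lemma integrable_ramp: "integrable M (\<lambda>x. ramp K (x i))"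
  by (rule integrable_const_bound[where B = 1]) (auto simp: ramp_bounds)

text \<open>Evaluating the joint characteristic function on a coordinate axis makes the
  one-dimensional continuity theorem available for each coordinate; this replaces a separate proof
  of tightness.\<close>

lemma char_marginal:
  assumes "i \<in> I"
  shows "char (distr M borel (\<lambda>x. x i)) t = chf (\<lambda>j. if j = i then t else 0)"
proof -
  have *: "(\<Sum>j\<in>I. (if j = i then t else 0) * x j) = t * x i" for x
  proof -
    have "(\<Sum>j\<in>I. (if j = i then t else 0) * x j) = (\<Sum>j\<in>I. if j = i then t * x j else 0)"
      by (rule sum.cong) auto
    then show ?thesis using assms finite_I by simp
  qed
  show ?thesis
    unfolding char_def chf_def * cis_conv_exp by (subst integral_distr) auto
qed

lemma ramp_integral_tendsto: "(\<lambda>K. \<integral>x. ramp (real K) (x i) \<partial>M) \<longlonglongrightarrow> 0"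
proof -
  have "(\<lambda>K. \<integral>x. ramp (real K) (x i) \<partial>M) \<longlonglongrightarrow> (\<integral>x. 0 \<partial>M)"
  proof (rule integral_dominated_convergence[where w = "\<lambda>_. 1"])
    show "AE x in M. (\<lambda>K. ramp (real K) (x i)) \<longlonglongrightarrow> 0"
    proof (rule AE_I2)
      fix x
      obtain N where "\<bar>x i\<bar> < real N" using reals_Archimedean2 by blast
      then have "eventually (\<lambda>K. ramp (real K) (x i) = 0) sequentially"
        by (auto simp: ramp_def eventually_sequentially intro!: exI[of _ N])
      then show "(\<lambda>K. ramp (real K) (x i)) \<longlonglongrightarrow> 0" by (rule tendsto_eventually)
    qed
  qed (auto simp: ramp_bounds)
  then show ?thesis by simp
qed

lemma integral_approx:
  fixes f g H :: "('i \<Rightarrow> real) \<Rightarrow> real"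
  assumes f: "f \<in> borel_measurable borel" "\<And>x. \<bar>f x\<bar> \<le> B" and g: "integrable M g" and H: "integrable M H"
    and fg: "\<And>x. (\<forall>i. i \<notin> I \<longrightarrow> x i = 0) \<Longrightarrow> \<bar>f x - g x\<bar> \<le> \<epsilon> + H x"
  shows "\<bar>(\<integral>x. f x \<partial>M) - (\<integral>x. g x \<partial>M)\<bar> \<le> \<epsilon> + (\<integral>x. H x \<partial>M)"
proof -
  have fint: "integrable M f"
    by (rule integrable_const_bound[where B = B]) (use f in auto)
  have "(\<integral>x. f x \<partial>M) - (\<integral>x. g x \<partial>M) = (\<integral>x. f x - g x \<partial>M)"
    by (rule Bochner_Integration.integral_diff[symmetric]) (use fint g in auto)
  also have "\<bar>\<dots>\<bar> \<le> (\<integral>x. \<bar>f x - g x\<bar> \<partial>M)"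
    by (rule integral_abs_bound)
  also have "\<dots> \<le> (\<integral>x. \<epsilon> + H x \<partial>M)"
    by (rule integral_mono_AE) (use fint g H fg support in auto)
  also have "\<dots> = \<epsilon> + (\<integral>x. H x \<partial>M)" using H by (simp add: prob_space)
  finally show ?thesis .
qed

end

text \<open>Expectations of trigonometric polynomials converge by the hypothesis on characteristic
  functions. On a large cube \<open>f\<close> is close to such a polynomial; outside, the error is
  at most 2 B + \<epsilon> and is paid for by \<open>H\<close>, whose integrals converge because the
  marginals do.\<close>

lemma levy_continuity_finite_dim:
  fixes M :: "nat \<Rightarrow> ('i::countable \<Rightarrow> real) measure" and f :: "('i \<Rightarrow> real) \<Rightarrow> real"
  assumes Mn: "\<And>n. rvec_measure (M n) I" and M': "rvec_measure M' I"
    and chf: "\<And>\<theta>. (\<lambda>n. rvec_measure.chf (M n) I \<theta>) \<longlonglongrightarrow> rvec_measure.chf M' I \<theta>"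
    and f: "continuous_on UNIV f" and bdd: "bounded (range f)"
  shows "(\<lambda>n. \<integral>x. f x \<partial>M n) \<longlonglongrightarrow> (\<integral>x. f x \<partial>M')"
proof -
  interpret Mn: rvec_measure "M n" I for n by (rule Mn)
  interpret M': rvec_measure M' I by (rule M')
  have I: "finite I" by (rule M'.finite_I)
  obtain B where B: "\<And>x. \<bar>f x\<bar> \<le> B" using bdd by (auto simp: bounded_iff)
  have B0: "0 \<le> B" using B[of "\<lambda>_. 0"] by linarith
  have fm: "f \<in> borel_measurable borel" using f by (rule borel_measurable_continuous_onI)
  have trig: "(\<lambda>n. \<integral>x. g x \<partial>M n) \<longlonglongrightarrow> (\<integral>x. g x \<partial>M')" if "g \<in> trig_polys I" for g
    using that
  proof (induction rule: trig_polys.induct)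
    case (monomial c \<theta>)
    show ?case using tendsto_mult_left[OF chf[of \<theta>], of c] by (simp add: Mn.chf_def M'.chf_def)
  next
    case (add g h)
    then show ?case using tendsto_add by (simp add: Mn.integrable_trig M'.integrable_trig)
  qed
  have ramp: "(\<lambda>n. \<integral>x. ramp K (x i) \<partial>M n) \<longlonglongrightarrow> (\<integral>x. ramp K (x i) \<partial>M')" if i: "i \<in> I" for K i
  proof -
    have rn: "real_distribution (distr (M n) borel (\<lambda>x. x i))" for n
      by (rule Mn.real_distribution_distr) measurable
    have r': "real_distribution (distr M' borel (\<lambda>x. x i))"
      by (rule M'.real_distribution_distr) measurable
    have "weak_conv_m (\<lambda>n. distr (M n) borel (\<lambda>x. x i)) (distr M' borel (\<lambda>x. x i))"
      by (rule levy_continuity[OF rn r']) (simp add: Mn.char_marginal M'.char_marginal i chf)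
    from weak_conv_imp_integral_bdd_continuous_conv[OF rn r' this isCont_ramp, of K 1]
    show ?thesis by (simp add: ramp_bounds integral_distr)
  qed
  show ?thesis
  proof (rule LIMSEQ_I)
    fix r :: real assume r: "0 < r"
    \<comment> \<open>Five errors of size at most \<epsilon> will add up: two approximations, two
      tails and one convergence.\<close>
    define \<epsilon> where "\<epsilon> = r / 10"
    have \<epsilon>: "0 < \<epsilon>" using r by (simp add: \<epsilon>_def)
    have "(\<lambda>K. (2 * B + \<epsilon>) * (\<Sum>i\<in>I. \<integral>x. ramp (real K) (x i) \<partial>M')) \<longlonglongrightarrow> (2 * B + \<epsilon>) * (\<Sum>i\<in>I. 0)"
      by (intro tendsto_intros M'.ramp_integral_tendsto)
    then have "eventually (\<lambda>K. (2 * B + \<epsilon>) * (\<Sum>i\<in>I. \<integral>x. ramp (real K) (x i) \<partial>M') < \<epsilon>) sequentially"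
      using \<epsilon> by (intro order_tendstoD(2)) auto
    \<comment> \<open>\<open>K\<close> is chosen for the limit measure alone; the tails under
      \<open>M n\<close> follow for large n by convergence of the ramp integrals.\<close>
    then obtain K where K: "(2 * B + \<epsilon>) * (\<Sum>i\<in>I. \<integral>x. ramp (real K) (x i) \<partial>M') < \<epsilon>"
      by (auto simp: eventually_sequentially)
    define H where "H x = (2 * B + \<epsilon>) * (\<Sum>i\<in>I. ramp (real K) (x i))" for x
    obtain g where g: "g \<in> trig_polys I"
      and g1: "\<And>x. (\<forall>i\<in>I. \<bar>x i\<bar> \<le> real K + 1) \<Longrightarrow> (\<forall>i. i \<notin> I \<longrightarrow> x i = 0) \<Longrightarrow> \<bar>f x - Re (g x)\<bar> \<le> \<epsilon>"
      and g2: "\<And>x. \<bar>Re (g x)\<bar> \<le> B + \<epsilon>"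
      by (rule trig_polys_dense[OF I f B _ \<epsilon>, of "real K + 1"]) auto
    have fg: "\<bar>f x - Re (g x)\<bar> \<le> \<epsilon> + H x" if x: "\<forall>i. i \<notin> I \<longrightarrow> x i = 0" for x
    proof (cases "\<forall>i\<in>I. \<bar>x i\<bar> \<le> real K + 1")
      case True
      have "0 \<le> H x" unfolding H_def using B0 \<epsilon> by (intro mult_nonneg_nonneg sum_nonneg ramp_bounds) auto
      then show ?thesis using g1[OF True x] by simp
    next
      case False
      then obtain i where i: "i \<in> I" "real K + 1 < \<bar>x i\<bar>" by auto
      then have "1 = ramp (real K) (x i)" by (simp add: ramp_def)
      also have "\<dots> \<le> (\<Sum>i\<in>I. ramp (real K) (x i))" using I i by (intro member_le_sum ramp_bounds) auto
      finally have "(2 * B + \<epsilon>) * 1 \<le> H x" unfolding H_def using B0 \<epsilon> by (intro mult_left_mono) auto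
      then have "2 * B + \<epsilon> \<le> H x" by simp
      then show ?thesis
        using abs_triangle_ineq4[of "f x" "Re (g x)"] B[of x] g2[of x] \<epsilon> by linarith
    qed
    have gn: "integrable (M n) (\<lambda>x. Re (g x))" "integrable (M n) H" for n
      using Mn.integrable_trig[OF g] by (auto simp: H_def[abs_def] Mn.integrable_ramp)
    have g': "integrable M' (\<lambda>x. Re (g x))" "integrable M' H"
      using M'.integrable_trig[OF g] by (auto simp: H_def[abs_def] M'.integrable_ramp)
    have An: "\<bar>(\<integral>x. f x \<partial>M n) - (\<integral>x. Re (g x) \<partial>M n)\<bar> \<le> \<epsilon> + (\<integral>x. H x \<partial>M n)" for n
      by (rule Mn.integral_approx[OF fm B gn fg])
    have A': "\<bar>(\<integral>x. f x \<partial>M') - (\<integral>x. Re (g x) \<partial>M')\<bar> \<le> \<epsilon> + (\<integral>x. H x \<partial>M')"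
      by (rule M'.integral_approx[OF fm B g' fg])
    have H': "(\<integral>x. H x \<partial>M') < \<epsilon>"
      using K by (simp add: H_def M'.integrable_ramp)
    have "(\<lambda>n. \<integral>x. H x \<partial>M n) \<longlonglongrightarrow> (\<integral>x. H x \<partial>M')"
      unfolding H_def by (simp add: Mn.integrable_ramp M'.integrable_ramp) (intro tendsto_intros ramp)
    then have evH: "eventually (\<lambda>n. (\<integral>x. H x \<partial>M n) < \<epsilon>) sequentially"
      using H' by (rule order_tendstoD(2))
    have "(\<lambda>n. \<integral>x. Re (g x) \<partial>M n) \<longlonglongrightarrow> (\<integral>x. Re (g x) \<partial>M')"
      using tendsto_Re[OF trig[OF g]] Mn.integrable_trig[OF g] M'.integrable_trig[OF g] by simp
    then have evg: "eventually (\<lambda>n. dist (\<integral>x. Re (g x) \<partial>M n) (\<integral>x. Re (g x) \<partial>M') < \<epsilon>) sequentially"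
      using \<epsilon> by (rule tendstoD)
    have "eventually (\<lambda>n. norm ((\<integral>x. f x \<partial>M n) - (\<integral>x. f x \<partial>M')) < r) sequentially"
      using evH evg
    proof eventually_elim
      case (elim n)
      then show ?case
        using An[of n] A' H' r unfolding dist_real_def real_norm_def \<epsilon>_def by linarith
    qed
    then show "\<exists>no. \<forall>n\<ge>no. norm ((\<integral>x. f x \<partial>M n) - (\<integral>x. f x \<partial>M')) < r"
      by (simp add: eventually_sequentially)
  qed
qed

section \<open>Gaussian vectors and square roots of covariance matrices\<close>

lemma borel_measurable_lin_map [measurable]: "lin_map l A \<in> borel_measurable (std_gauss_vec l)"
proof (rule measurable_coordinatewise_then_product)
  fix i
  have "(\<lambda>g. g k) \<in> borel_measurable (std_gauss_vec l)" if "k \<in> {1..l}" for k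
    using measurable_component_singleton[OF that, of "\<lambda>_. density lborel std_normal_density"]
    by (simp add: std_gauss_vec_def cong: measurable_cong_sets)
  then have "(\<lambda>g. \<Sum>k\<in>{1..l}. A i k * g k) \<in> borel_measurable (std_gauss_vec l)"
    by (intro borel_measurable_sum borel_measurable_times) auto
  then show "(\<lambda>g. lin_map l A g i) \<in> borel_measurable (std_gauss_vec l)"
    unfolding lin_map_def by (cases "i \<in> {1..l}") (simp_all only: if_True if_False borel_measurable_const)
qed

lemma prob_space_std_gauss_vec: "prob_space (std_gauss_vec l)"
  unfolding std_gauss_vec_def
  by (rule prob_space_PiM) (rule prob_space_normal_density, simp)

lemma rvec_measure_gauss: "rvec_measure (distr (std_gauss_vec l) borel (lin_map l A)) {1..l}"
proof -
  interpret prob_space "std_gauss_vec l" by (rule prob_space_std_gauss_vec)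
  interpret D: prob_space "distr (std_gauss_vec l) borel (lin_map l A)"
    by (rule prob_space_distr) measurable
  show ?thesis
  proof
    show "AE x in distr (std_gauss_vec l) borel (lin_map l A). \<forall>i. i \<notin> {1..l} \<longrightarrow> x i = 0"
      by (subst AE_distr_iff) (auto simp: lin_map_def)
  qed auto
qed

text \<open>The phase is linear in g with coefficients c = A^T \<theta>, so independence factors the
  integral into standard normal characteristic functions at the c k.\<close>

lemma chf_gauss:
  "rvec_measure.chf (distr (std_gauss_vec l) borel (lin_map l A)) {1..l} \<theta> =
    of_real (exp (- (\<Sum>k\<in>{1..l}. (\<Sum>i\<in>{1..l}. \<theta> i * A i k)\<^sup>2) / 2))"
proof -
  interpret R: rvec_measure "distr (std_gauss_vec l) borel (lin_map l A)" "{1..l}"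
    by (rule rvec_measure_gauss)
  interpret N: real_distribution std_normal_distribution by (rule real_dist_normal_dist)
  interpret product_sigma_finite "\<lambda>_::nat. std_normal_distribution" ..
  define c where "c k = (\<Sum>i\<in>{1..l}. \<theta> i * A i k)" for k
  have "R.chf \<theta> = (\<integral>g. cis (\<Sum>i\<in>{1..l}. \<theta> i * lin_map l A g i) \<partial>std_gauss_vec l)"
    unfolding R.chf_def by (subst integral_distr) (auto simp: cis_conv_exp)
  also have "\<dots> = (\<integral>g. (\<Prod>k\<in>{1..l}. iexp (c k * g k)) \<partial>std_gauss_vec l)"
  proof (rule Bochner_Integration.integral_cong[OF refl])
    fix g :: "nat \<Rightarrow> real"
    have "(\<Sum>i\<in>{1..l}. \<theta> i * lin_map l A g i) = (\<Sum>k\<in>{1..l}. c k * g k)"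
      unfolding lin_map_def c_def sum_distrib_right
      by (subst sum.swap) (simp add: sum_distrib_left mult.assoc)
    then show "cis (\<Sum>i\<in>{1..l}. \<theta> i * lin_map l A g i) = (\<Prod>k\<in>{1..l}. iexp (c k * g k))"
      by (simp add: cis_conv_exp exp_sum[symmetric] sum_distrib_left del: of_real_mult)
  qed
  also have "\<dots> = (\<Prod>k\<in>{1..l}. char std_normal_distribution (c k))"
    unfolding std_gauss_vec_def char_def
    by (rule product_integral_prod) (auto intro!: N.integrable_const_bound[where B = 1])
  also have "\<dots> = of_real (exp (- (\<Sum>k\<in>{1..l}. (c k)\<^sup>2) / 2))"
    by (simp add: char_std_normal_distribution exp_sum[symmetric] sum_negf sum_divide_distrib
        flip: of_real_prod)
  finally show ?thesis by (simp add: c_def)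
qed

text \<open>One Schur complement step per index; when the pivot \<open>P x x\<close> vanishes, the column
  \<open>P i x / sqrt (P x x)\<close> is \<open>0\<close> by division by zero, as it should be.\<close>

lemma psd_factorization:
  fixes P :: "'i \<Rightarrow> 'i \<Rightarrow> real"
  assumes "finite S" and sym: "\<And>i j. P i j = P j i"
    and psd: "\<And>\<theta>. 0 \<le> (\<Sum>i\<in>S. \<Sum>j\<in>S. \<theta> i * \<theta> j * P i j)"
  shows "\<exists>A. \<forall>i\<in>S. \<forall>j\<in>S. P i j = (\<Sum>k\<in>S. A i k * A j k)"
  using assms
proof (induction S arbitrary: P rule: finite_induct)
  case (insert x F)
  define v where "v i = P i x / sqrt (P x x)" for i
  define Q where "Q i j = P i j - v i * v j" for i j
  have quad: "(\<Sum>i\<in>insert x F. \<Sum>j\<in>insert x F. \<theta> i * \<theta> j * P i j) =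
      (\<theta> x)\<^sup>2 * P x x + 2 * \<theta> x * (\<Sum>i\<in>F. \<theta> i * P i x) + (\<Sum>i\<in>F. \<Sum>j\<in>F. \<theta> i * \<theta> j * P i j)" for \<theta>
  proof -
    have 1: "(\<Sum>j\<in>F. \<theta> x * \<theta> j * P x j) = \<theta> x * (\<Sum>i\<in>F. \<theta> i * P i x)"
      unfolding sum_distrib_left
      by (rule sum.cong[OF refl]) (subst insert.prems(1), simp only: mult.assoc)
    have 2: "(\<Sum>i\<in>F. \<theta> i * \<theta> x * P i x) = \<theta> x * (\<Sum>i\<in>F. \<theta> i * P i x)"
      unfolding sum_distrib_left by (simp only: mult_ac)
    show ?thesis
      using insert.hyps by (simp add: sum.distrib 1 2 power2_eq_square)
  qed
  have pivot: "0 \<le> P x x"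
  proof -
    have "(\<Sum>i\<in>F. (if i = x then 1 else 0) * P i x) = 0"
      "(\<Sum>i\<in>F. \<Sum>j\<in>F. (if i = x then 1 else 0) * (if j = x then 1 else 0) * P i j) = (0::real)"
      using insert.hyps by (auto intro!: sum.neutral)
    then show ?thesis
      using insert.prems(2)[of "\<lambda>i. if i = x then 1 else 0"] unfolding quad by simp
  qed
  have zero: "P i x = 0" if "P x x = 0" "i \<in> F" for i
  proof (rule ccontr)
    assume nz: "P i x \<noteq> 0"
    \<comment> \<open>With zero pivot the form at s e_x + e_i is 2 s P i x + P i i, linear in s;
      this s makes it -1.\<close>
    define s where "s = - (P i i + 1) / (2 * P i x)"
    let ?\<theta> = "\<lambda>j. if j = x then s else if j = i then 1 else 0"
    have xi: "x \<noteq> i" using insert.hyps that by auto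
    have 1: "(\<Sum>j\<in>F. ?\<theta> j * P j x) = P i x"
    proof -
      have "(\<Sum>j\<in>F. ?\<theta> j * P j x) = (\<Sum>j\<in>F. if j = i then P i x else 0)"
        using insert.hyps by (intro sum.cong) auto
      then show ?thesis using insert.hyps that by simp
    qed
    have 2: "(\<Sum>j\<in>F. \<Sum>k\<in>F. ?\<theta> j * ?\<theta> k * P j k) = P i i"
    proof -
      have "(\<Sum>j\<in>F. \<Sum>k\<in>F. ?\<theta> j * ?\<theta> k * P j k) = (\<Sum>j\<in>F. \<Sum>k\<in>F. if j = i then if k = i then P i i else 0 else 0)"
        using insert.hyps by (intro sum.cong refl) auto
      also have "\<dots> = (\<Sum>j\<in>F. if j = i then (\<Sum>k\<in>F. if k = i then P i i else 0) else 0)"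
        by (intro sum.cong refl) auto
      finally show ?thesis using insert.hyps that by simp
    qed
    have "0 \<le> 2 * s * P i x + P i i"
      using insert.prems(2)[of ?\<theta>] that(1) unfolding quad 1 2 by simp
    moreover have "2 * s * P i x = - (P i i + 1)" using nz by (simp add: s_def)
    ultimately show False by linarith
  qed
  have vx: "v i * v x = P i x" if "i \<in> F" for i
    using zero[OF _ that] pivot by (cases "P x x = 0") (auto simp: v_def)
  have vxx: "v x * v x = P x x"
    using pivot by (auto simp: v_def)
  have "0 \<le> (\<Sum>i\<in>F. \<Sum>j\<in>F. \<theta> i * \<theta> j * Q i j)" for \<theta>
  proof -
    define t where "t = (\<Sum>i\<in>F. \<theta> i * v i)"
    have "(\<Sum>i\<in>F. \<Sum>j\<in>F. \<theta> i * \<theta> j * Q i j) = (\<Sum>i\<in>F. \<Sum>j\<in>F. \<theta> i * \<theta> j * P i j) - t\<^sup>2"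
      unfolding t_def power2_eq_square sum_product
      by (simp add: Q_def sum_subtractf[symmetric] algebra_simps)
    moreover have "0 \<le> (\<Sum>i\<in>F. \<Sum>j\<in>F. \<theta> i * \<theta> j * P i j) - t\<^sup>2"
    proof -
      \<comment> \<open>For a nonzero pivot this entry at x minimises the form in that coordinate,
        and completing the square subtracts exactly t^2. For a zero pivot t itself is 0.\<close>
      let ?\<eta> = "\<lambda>i. if i = x then - t / sqrt (P x x) else \<theta> i"
      have 1: "(\<Sum>i\<in>F. ?\<eta> i * P i x) = t * sqrt (P x x)"
      proof -
        have "(\<Sum>i\<in>F. ?\<eta> i * P i x) = (\<Sum>i\<in>F. \<theta> i * v i * sqrt (P x x))"
        proof (rule sum.cong[OF refl])
          fix i assume i: "i \<in> F"
          then have "i \<noteq> x" using insert.hyps by auto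
          moreover have "v i * sqrt (P x x) = P i x" using zero[OF _ i] by (cases "P x x = 0") (auto simp: v_def)
          ultimately show "?\<eta> i * P i x = \<theta> i * v i * sqrt (P x x)" by simp
        qed
        then show ?thesis by (simp add: t_def sum_distrib_right)
      qed
      have 2: "(\<Sum>i\<in>F. \<Sum>j\<in>F. ?\<eta> i * ?\<eta> j * P i j) = (\<Sum>i\<in>F. \<Sum>j\<in>F. \<theta> i * \<theta> j * P i j)"
        using insert.hyps by (intro sum.cong refl) auto
      have "0 \<le> (- t / sqrt (P x x))\<^sup>2 * P x x + 2 * (- t / sqrt (P x x)) * (t * sqrt (P x x))
          + (\<Sum>i\<in>F. \<Sum>j\<in>F. \<theta> i * \<theta> j * P i j)"
        using insert.prems(2)[of ?\<eta>] unfolding quad 1 2 by simp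
      moreover have "(- t / sqrt (P x x))\<^sup>2 * P x x + 2 * (- t / sqrt (P x x)) * (t * sqrt (P x x)) = - t\<^sup>2"
        if "P x x \<noteq> 0" using that pivot by (simp add: power_divide power2_eq_square)
      moreover have "t = 0" if "P x x = 0" using that by (simp add: t_def v_def)
      ultimately show ?thesis by (cases "P x x = 0") auto
    qed
    ultimately show ?thesis by simp
  qed
  moreover have "Q i j = Q j i" for i j using insert.prems(1)[of i j] by (simp add: Q_def)
  ultimately obtain A where A: "\<forall>i\<in>F. \<forall>j\<in>F. Q i j = (\<Sum>k\<in>F. A i k * A j k)"
    using insert.IH[of Q] by blast
  have AF: "(\<Sum>k\<in>F. A i k * A j k) = P i j - v i * v j" if "i \<in> F" "j \<in> F" for i j
    using A that by (simp add: Q_def)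
  \<comment> \<open>As in a Cholesky factor, \<open>v\<close> is the new column x, and row x is 0 in
    the old columns.\<close>
  define A' where "A' i k = (if k = x then v i else if i = x then 0 else A i k)" for i k
  have F: "(\<Sum>k\<in>F. A' i k * A' j k) = (if i = x \<or> j = x then 0 else \<Sum>k\<in>F. A i k * A j k)" for i j
  proof -
    have "(\<Sum>k\<in>F. A' i k * A' j k) = (\<Sum>k\<in>F. if i = x \<or> j = x then 0 else A i k * A j k)"
      using insert.hyps by (intro sum.cong) (auto simp: A'_def)
    then show ?thesis by auto
  qed
  have "P i j = (\<Sum>k\<in>insert x F. A' i k * A' j k)" if ij: "i \<in> insert x F" "j \<in> insert x F" for i j
  proof -
    have "(\<Sum>k\<in>insert x F. A' i k * A' j k) = v i * v j + (\<Sum>k\<in>F. A' i k * A' j k)"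
      using insert.hyps by (simp add: A'_def)
    also have "\<dots> = P i j"
      unfolding F using ij vx[of i] vx[of j] vxx insert.prems(1)[of x j] by (auto simp: AF mult.commute)
    finally show ?thesis by simp
  qed
  then show ?case by blast
qed simp

section \<open>Exponential tails of the block length\<close>

text \<open>The q-Pochhammer symbol (q; q)_n, which is (1 - q)^n times the q-factorial of n.\<close>

definition qpoch :: "real \<Rightarrow> nat \<Rightarrow> real" where
  "qpoch q n = (\<Prod>k<n. 1 - q ^ Suc k)"

context
  fixes q :: real
  assumes q: "0 < q" "q < 1"
begin

lemma q_power: "0 < q ^ Suc k" "q ^ Suc k < 1"
  using q by (auto intro: power_Suc_less_one simp del: power_Suc)

lemma qpoch_pos: "0 < qpoch q n"
  unfolding qpoch_def using q_power by (intro prod_pos) (auto simp del: power_Suc)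

lemma qpoch_Suc: "qpoch q (Suc n) = qpoch q n * (1 - q ^ Suc n)"
  by (simp add: qpoch_def)

lemma qpoch_le_1: "qpoch q n \<le> 1"
  unfolding qpoch_def using q_power by (intro prod_le_1) (auto simp del: power_Suc intro: less_imp_le)

lemma qpoch_diff: "qpoch q n - qpoch q (Suc n) = q ^ Suc n * qpoch q n"
  by (simp add: qpoch_Suc algebra_simps)

lemma qpoch_convergent: "\<exists>c>0. qpoch q \<longlonglongrightarrow> c"
proof -
  let ?f = "\<lambda>k. 1 + - (q ^ Suc k)"
  have cv: "convergent_prod ?f"
  proof (rule summable_imp_convergent_prod_real)
    have "summable (\<lambda>k. q * q ^ k)" using q by (intro summable_mult summable_geometric) auto
    then show "summable (\<lambda>k. \<bar>- (q ^ Suc k)\<bar>)" using q by (simp add: abs_mult)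
    show "- (q ^ Suc k) \<noteq> - 1" for k using q_power[of k] by simp
  qed
  have ne: "?f k \<noteq> 0" for k using q_power[of k] by simp
  have lim: "qpoch q \<longlonglongrightarrow> prodinf ?f"
  proof (rule LIMSEQ_imp_Suc)
    show "(\<lambda>n. qpoch q (Suc n)) \<longlonglongrightarrow> prodinf ?f"
      using convergent_prod_LIMSEQ[OF cv] by (simp add: qpoch_def lessThan_Suc_atMost del: prod.lessThan_Suc)
  qed
  moreover have "prodinf ?f \<noteq> 0" by (rule prodinf_nonzero[OF cv ne])
  moreover have "0 \<le> prodinf ?f"
    by (rule LIMSEQ_le_const[OF lim]) (auto intro!: exI[of _ 0] less_imp_le qpoch_pos)
  ultimately show ?thesis by (intro exI[of _ "prodinf ?f"]) auto
qed

definition qlim :: real where "qlim = lim (qpoch q)"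

lemma qpoch_LIMSEQ: "qpoch q \<longlonglongrightarrow> qlim"
  unfolding qlim_def using qpoch_convergent convergentI convergent_LIMSEQ_iff by blast

lemma qlim_pos: "0 < qlim"
  using qpoch_convergent qpoch_LIMSEQ LIMSEQ_unique by metis

lemma qlim_le_1: "qlim \<le> 1"
  by (rule LIMSEQ_le_const2[OF qpoch_LIMSEQ]) (use qpoch_le_1 in blast)

text \<open>Each step lowers the product by q^(n+1) times a factor at most 1, so a geometric series
  bounds the whole remaining drop. This rate makes \<open>u - c\<close> absolutely summable.\<close>

lemma qpoch_qlim_bound: "\<bar>qpoch q n - qlim\<bar> \<le> q ^ Suc n / (1 - q)"
proof -
  have "0 \<le> qpoch q n - qpoch q (n + j) \<and> qpoch q n - qpoch q (n + j) \<le> q ^ Suc n * (1 - q ^ j) / (1 - q)" for j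
  proof (induction j)
    case (Suc j)
    have "qpoch q (n + j) - qpoch q (n + Suc j) = q ^ Suc (n + j) * qpoch q (n + j)"
      using qpoch_diff[of "n + j"] by simp
    moreover have "0 \<le> q ^ Suc (n + j) * qpoch q (n + j)"
      using q_power[of "n + j"] qpoch_pos[of "n + j"] by (simp del: power_Suc)
    moreover have "q ^ Suc (n + j) * qpoch q (n + j) \<le> q ^ Suc (n + j) * 1"
      using q_power[of "n + j"] qpoch_le_1[of "n + j"] by (intro mult_left_mono) (auto simp del: power_Suc)
    moreover have "q ^ Suc n * (1 - q ^ j) / (1 - q) + q ^ Suc (n + j) = q ^ Suc n * (1 - q ^ Suc j) / (1 - q)"
      using q by (simp add: field_simps power_add)
    ultimately show ?case using Suc.IH by linarith
  qed simp
  then have A: "0 \<le> qpoch q n - qpoch q (n + j)"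
    "qpoch q n - qpoch q (n + j) \<le> q ^ Suc n * (1 - q ^ j) / (1 - q)" for j by auto
  have B: "q ^ Suc n * (1 - q ^ j) / (1 - q) \<le> q ^ Suc n / (1 - q)" for j
    using q by (intro divide_right_mono) (auto simp: mult_left_le)
  have *: "\<bar>qpoch q n - qpoch q (n + j)\<bar> \<le> q ^ Suc n / (1 - q)" for j
    using A[of j] B[of j] by linarith
  have "(\<lambda>j. \<bar>qpoch q n - qpoch q (n + j)\<bar>) \<longlonglongrightarrow> \<bar>qpoch q n - qlim\<bar>"
    using LIMSEQ_ignore_initial_segment[OF qpoch_LIMSEQ, of n]
    by (intro tendsto_intros) (simp add: add.commute)
  then show ?thesis by (rule LIMSEQ_le_const2) (use * in blast)
qed

lemma summable_qpoch_diff: "summable (\<lambda>n. \<bar>qpoch q n - qlim\<bar>)"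
proof (rule summable_comparison_test'[of "\<lambda>n. q / (1 - q) * q ^ n" 0])
  show "summable (\<lambda>n. q / (1 - q) * q ^ n)"
    using q by (intro summable_mult summable_geometric) auto
  show "norm \<bar>qpoch q n - qlim\<bar> \<le> q / (1 - q) * q ^ n" for n
    using qpoch_qlim_bound[of n] by simp
qed

text \<open>In generating functions, \<open>(1 - P) U = 1\<close>, so the tails \<open>R = (1 - P) / (1 - X)\<close> satisfy
  \<open>R * ((1 - X) U) = 1\<close>, where \<open>(1 - X) U = 1 - A\<close> and \<open>A\<close> has coefficients \<open>q^k u_(k-1)\<close> of total
  mass \<open>1 - qlim < 1\<close>.\<close>

lemma renewal_exponential_tail:
  fixes p :: "nat \<Rightarrow> real"
  assumes rec: "\<And>n. qpoch q n = (if n = 0 then 1 else 0) + (\<Sum>k\<le>n. p k * qpoch q (n - k))"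
  shows "\<exists>r C. 0 < r \<and> r < 1 \<and> (\<forall>n. p n \<le> C * r ^ n)"
proof -
  \<comment> \<open>The drops of \<open>qpoch\<close>. They are nonnegative and at most q^k, and
    they form a defective renewal kernel for the tails \<open>R\<close>.\<close>
  define a where "a k = (case k of 0 \<Rightarrow> 0 | Suc j \<Rightarrow> q ^ Suc j * qpoch q j)" for k
  define R where "R n = 1 - (\<Sum>k\<le>n. p k)" for n
  define U P A S where "U = Abs_fps (qpoch q)" and "P = Abs_fps p" and "A = Abs_fps a"
    and "S = Abs_fps (\<lambda>_. 1 :: real)"
  have U: "U = 1 + P * U"
    by (rule fps_ext, subst U_def, subst fps_nth_Abs_fps, subst rec)
       (simp add: fps_mult_nth P_def U_def atLeast0AtMost)
  have S: "S * (1 - fps_X) = 1"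
    by (rule fps_ext) (simp add: S_def algebra_simps fps_X_mult_nth)
  have A: "1 - A = (1 - fps_X) * U"
  proof (rule fps_ext)
    fix n show "fps_nth (1 - A) n = fps_nth ((1 - fps_X) * U) n"
      using qpoch_diff[of "n - 1"]
      by (cases n) (simp_all add: A_def U_def a_def left_diff_distrib fps_X_mult_nth qpoch_def[of _ 0])
  qed
  have "(1 - P) * S * (1 - A) = ((1 - P) * U) * (S * (1 - fps_X))"
    unfolding A by (simp only: mult_ac)
  also have "(1 - P) * U = 1" using U by (simp add: algebra_simps)
  finally have "(1 - P) * S = 1 + A * ((1 - P) * S)" unfolding S by (simp add: algebra_simps)
  moreover have "(1 - P) * S = Abs_fps R"
    by (rule fps_ext) (simp add: S_def P_def R_def fps_mult_nth atLeast0AtMost left_diff_distrib)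
  ultimately have Req: "Abs_fps R = 1 + A * Abs_fps R" by simp
  have "fps_nth (Abs_fps R) n = (if n = 0 then 1 else 0) + (\<Sum>k\<le>n. a k * R (n - k))" for n
    by (subst Req) (simp add: fps_mult_nth A_def atLeast0AtMost)
  then have Rrec: "R n = (if n = 0 then 1 else 0) + (\<Sum>k\<le>n. a k * R (n - k))" for n
    unfolding fps_nth_Abs_fps .
  have a0: "0 \<le> a k" for k
    unfolding a_def using q_power qpoch_pos by (auto split: nat.split simp del: power_Suc intro!: mult_nonneg_nonneg less_imp_le)
  have a_le: "a k \<le> q ^ k" for k
    unfolding a_def using q_power qpoch_le_1 by (auto split: nat.split simp del: power_Suc intro!: mult_left_le less_imp_le)
  \<comment> \<open>The midpoint between 1 and 1 / q: beyond 1, yet with q X < 1, so that the power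
    series of \<open>a\<close> converges there.\<close>
  define X where "X = (1 + 1 / q) / 2"
  have X1: "1 < X" using q by (simp add: X_def field_simps)
  have qX: "q * X < 1" using q by (simp add: X_def field_simps)
  have smX: "summable (\<lambda>n. a n * X ^ n)"
  proof (rule summable_comparison_test'[of "\<lambda>n. (q * X) ^ n" 0])
    show "summable (\<lambda>n. (q * X) ^ n)" using q X1 qX by (intro summable_geometric) auto
    show "norm (a n * X ^ n) \<le> (q * X) ^ n" for n
      using a0[of n] a_le[of n] X1 by (simp add: power_mult_distrib abs_mult mult_right_mono)
  qed
  define G where "G x = (\<Sum>n. a n * x ^ n)" for x
  have "isCont G 1"
    unfolding G_def[abs_def] by (rule isCont_powser[OF smX]) (use X1 in simp)
  moreover have "G 1 < 1"
  proof -
    have "(\<lambda>n. qpoch q n - qpoch q (Suc n)) sums (qpoch q 0 - qlim)"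
      by (rule telescope_sums'[OF qpoch_LIMSEQ])
    then have "(\<lambda>n. a (Suc n)) sums (1 - qlim)"
      by (simp add: a_def qpoch_diff qpoch_def[of _ 0] del: power_Suc)
    then have "a sums (1 - qlim)" by (subst (asm) sums_Suc_iff) (simp add: a_def)
    then show ?thesis using qlim_pos by (simp add: G_def sums_unique[symmetric])
  qed
  ultimately have "eventually (\<lambda>x. G x < 1) (at 1)"
    unfolding isCont_def by (rule order_tendstoD(2))
  then obtain d where d: "0 < d" "\<And>x. x \<noteq> 1 \<Longrightarrow> dist x 1 < d \<Longrightarrow> G x < 1"
    by (auto simp: eventually_at)
  \<comment> \<open>Close enough to 1 for G x < 1 by continuity, yet larger than 1; its inverse
    becomes the rate of decay.\<close>
  define x where "x = 1 + min d (X - 1) / 2"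
  have x1: "1 < x" and xX: "x < X" and xd: "dist x 1 < d"
    using d(1) X1 by (auto simp: x_def dist_real_def min_def field_simps)
  have Gx: "G x < 1" using d(2)[of x] x1 xd by simp
  have smx: "summable (\<lambda>n. a n * x ^ n)"
  proof (rule summable_comparison_test'[OF smX, of 0])
    show "norm (a n * x ^ n) \<le> a n * X ^ n" for n
      using a0[of n] x1 xX by (auto simp: abs_mult intro!: mult_left_mono power_mono)
  qed
  \<comment> \<open>Weighted by x^n, the recursion for \<open>R\<close> has total kernel mass at
    most G x < 1, so the bound 1 reproduces itself.\<close>
  have R0: "0 \<le> R n \<and> R n * x ^ n \<le> 1" for n
  proof (induction n rule: less_induct)
    case (less n)
    show ?case
    proof (cases "n = 0")
      case True
      then show ?thesis using Rrec[of 0] by (simp add: a_def)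
    next
      case False
      have summand: "0 \<le> a k * R (n - k) \<and> a k * R (n - k) * x ^ n \<le> a k * x ^ k" if "k \<le> n" for k
      proof (cases "k = 0")
        case True
        then show ?thesis by (simp add: a_def)
      next
        case k: False
        then have IH: "0 \<le> R (n - k)" "R (n - k) * x ^ (n - k) \<le> 1" using less[of "n - k"] that False by auto
        have "a k * R (n - k) * x ^ n = (a k * x ^ k) * (R (n - k) * x ^ (n - k))"
          using that by (simp add: power_add[symmetric] mult_ac)
        also have "\<dots> \<le> (a k * x ^ k) * 1"
          using IH a0 x1 by (intro mult_left_mono) auto
        finally show ?thesis using IH a0 by simp
      qed
      have "0 \<le> R n" using False summand by (subst Rrec) (auto intro!: sum_nonneg)
      moreover have "R n * x ^ n \<le> (\<Sum>k\<le>n. a k * x ^ k)"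
        using False summand by (subst Rrec) (auto simp: sum_distrib_right intro!: sum_mono)
      moreover have "(\<Sum>k\<le>n. a k * x ^ k) \<le> G x"
        unfolding G_def using a0 x1 by (intro sum_le_suminf smx) auto
      ultimately show ?thesis using Gx by simp
    qed
  qed
  have "p n \<le> x * (1 / x) ^ n" for n
  proof (cases n)
    case 0
    have "p 0 = 0" using rec[of 0] by (simp add: qpoch_def)
    then show ?thesis using 0 x1 by simp
  next
    case (Suc m)
    \<comment> \<open>A block probability is a drop of the tail, hence at most the tail one index
      earlier; that shift is the extra factor x.\<close>
    have "p n = R m - R n" by (simp add: R_def Suc)
    also have "\<dots> \<le> R m" using R0[of n] by simp
    also have "\<dots> \<le> 1 / x ^ m" using R0[of m] x1 by (simp add: field_simps)
    finally show ?thesis using Suc x1 by (simp add: power_divide)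
  qed
  then show ?thesis using x1 by (intro exI[of _ "1 / x"] exI[of _ x]) auto
qed

end

lemma summable_cube_geometric:
  fixes r :: real
  assumes "0 < r" "r < 1"
  shows "summable (\<lambda>n. real n ^ 3 * r ^ n)"
proof -
  \<comment> \<open>Of the four factors s^n in r^n, three absorb the three powers of n and the
    fourth is summed.\<close>
  define s where "s = root 4 r"
  have s: "0 < s" "s < 1" "s ^ 4 = r"
    using assms by (auto simp: s_def real_root_gt_0_iff)
  have "(\<lambda>n. real n * s ^ n) \<longlonglongrightarrow> 0"
    using powser_times_n_limit_0[of s] s by simp
  then have "Bseq (\<lambda>n. real n * s ^ n)" by (intro convergent_imp_Bseq convergentI)
  then obtain K where K: "0 < K" "\<And>n. norm (real n * s ^ n) \<le> K" by (auto simp: Bseq_def)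
  show ?thesis
  proof (rule summable_comparison_test'[of "\<lambda>n. K ^ 3 * s ^ n" 0])
    show "summable (\<lambda>n. K ^ 3 * s ^ n)" using s by (intro summable_mult summable_geometric) auto
    fix n
    have "real n ^ 3 * r ^ n = (real n * s ^ n) ^ 3 * s ^ n"
      unfolding s(3)[symmetric] by (simp add: power_mult_distrib power_mult[symmetric] power_add[symmetric])
    moreover have "(real n * s ^ n) ^ 3 \<le> K ^ 3" using K(2)[of n] s by (intro power_mono) auto
    ultimately show "norm (real n ^ 3 * r ^ n) \<le> K ^ 3 * s ^ n"
      using s assms by (auto intro!: mult_right_mono)
  qed
qed

section \<open>The central limit theorem\<close>

context
  fixes q :: real
  assumes q: "0 < q" "q < 1"
begin

text \<open>The power of 1 - q is multiplicative in the length, so the weight still factors over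
  direct sums, while the total mass becomes \<open>qpoch q n\<close>.\<close>

definition wt :: "nat \<Rightarrow> (nat \<Rightarrow> nat) \<Rightarrow> real" where
  "wt n \<pi> = (1 - q) ^ n * q ^ inv_count n \<pi>"

lemma wt_pos: "0 < wt n \<pi>"
  using q by (simp add: wt_def)

lemma wt_direct_sum:
  "\<sigma> \<in> perms k \<Longrightarrow> \<tau> \<in> perms m \<Longrightarrow> wt (k + m) (direct_sum k \<sigma> \<tau>) = wt k \<sigma> * wt m \<tau>"
  by (simp add: wt_def inv_count_direct_sum power_add mult_ac)

lemma sum_wt: "(\<Sum>\<pi>\<in>perms n. wt n \<pi>) = qpoch q n"
proof -
  have "(\<Sum>\<pi>\<in>perms n. wt n \<pi>) = (1 - q) ^ n * (\<Prod>k<n. \<Sum>j\<le>k. q ^ j)"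
    by (simp add: wt_def sum_distrib_left[symmetric] sum_power_inv_count)
  also have "\<dots> = (\<Prod>k<n. (1 - q) * (\<Sum>j\<le>k. q ^ j))" by (simp add: prod.distrib)
  also have "\<dots> = qpoch q n" unfolding qpoch_def by (simp only: sum_gp_basic)
  finally show ?thesis .
qed

lemma mallows_prob_eq: "mallows_prob n q \<pi> = wt n \<pi> / qpoch q n"
proof -
  have "qpoch q n = (1 - q) ^ n * (\<Sum>\<sigma>\<in>perms n. q ^ inv_count n \<sigma>)"
    by (simp add: sum_wt[symmetric] wt_def sum_distrib_left)
  then show ?thesis using q by (simp add: mallows_prob_def wt_def)
qed

lemma perms_0: "perms 0 = {id}"
  by (simp add: perms_def)

lemma indec_0: "indec 0 = {}"
  by (simp add: indec_def)

text \<open>One equation for every statistic multiplicative along direct sums: \<open>h\<close>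
  constantly 1 yields the recursion of \<open>qpoch\<close>, and \<open>cis\<close> of an additive
  statistic that of the Fourier sums. The term k = 0 contributes nothing because there is no empty
  block.\<close>

lemma wt_renewal:
  fixes h :: "nat \<Rightarrow> (nat \<Rightarrow> nat) \<Rightarrow> 'a::{comm_ring_1, real_algebra_1}"
  assumes h0: "h 0 id = 1"
    and h: "\<And>k m \<sigma> \<tau>. \<sigma> \<in> perms k \<Longrightarrow> \<tau> \<in> perms m \<Longrightarrow> h (k + m) (direct_sum k \<sigma> \<tau>) = h k \<sigma> * h m \<tau>"
  shows "(\<Sum>\<pi>\<in>perms n. of_real (wt n \<pi>) * h n \<pi>) = (if n = 0 then 1 else 0) +
    (\<Sum>k\<le>n. (\<Sum>\<sigma>\<in>indec k. of_real (wt k \<sigma>) * h k \<sigma>) * (\<Sum>\<tau>\<in>perms (n - k). of_real (wt (n - k) \<tau>) * h (n - k) \<tau>))"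
proof (cases "n = 0")
  case True
  then show ?thesis by (simp add: perms_0 indec_0 h0 wt_def inv_count_def)
next
  case False
  have "(\<Sum>\<pi>\<in>perms n. of_real (wt n \<pi>) * h n \<pi>) = (\<Sum>k\<le>n. \<Sum>\<sigma>\<in>indec k. \<Sum>\<tau>\<in>perms (n - k).
      of_real (wt n (direct_sum k \<sigma> \<tau>)) * h n (direct_sum k \<sigma> \<tau>))"
    using False by (intro sum_perms_direct_sum) simp
  also have "\<dots> = (\<Sum>k\<le>n. (\<Sum>\<sigma>\<in>indec k. of_real (wt k \<sigma>) * h k \<sigma>) *
      (\<Sum>\<tau>\<in>perms (n - k). of_real (wt (n - k) \<tau>) * h (n - k) \<tau>))"
    unfolding sum_product
  proof (intro sum.cong refl)
    fix k \<sigma> \<tau> assume "k \<in> {..n}" "\<sigma> \<in> indec k" "\<tau> \<in> perms (n - k)"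
    then have "k + (n - k) = n" "\<sigma> \<in> perms k" "\<tau> \<in> perms (n - k)" by (auto simp: indec_def)
    then show "of_real (wt n (direct_sum k \<sigma> \<tau>)) * h n (direct_sum k \<sigma> \<tau>) =
        of_real (wt k \<sigma>) * h k \<sigma> * (of_real (wt (n - k) \<tau>) * h (n - k) \<tau>)"
      using h[of \<sigma> k \<tau> "n - k"] wt_direct_sum[of \<sigma> k \<tau> "n - k"] by (simp add: mult_ac)
  qed
  finally show ?thesis using False by simp
qed

definition mass :: "nat \<Rightarrow> real" where
  "mass k = (\<Sum>\<sigma>\<in>indec k. wt k \<sigma>)"

lemma qpoch_renewal: "qpoch q n = (if n = 0 then 1 else 0) + (\<Sum>k\<le>n. mass k * qpoch q (n - k))"
  using wt_renewal[of "\<lambda>_ _. 1 :: real" n] by (simp add: sum_wt mass_def)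

lemma mass_nonneg: "0 \<le> mass k"
  unfolding mass_def by (intro sum_nonneg less_imp_le wt_pos)

lemma summable_mass: "summable (\<lambda>k. real k ^ 3 * mass k)"
proof -
  obtain r C where r: "0 < r" "r < 1" "\<And>n. mass n \<le> C * r ^ n"
    using renewal_exponential_tail[OF q qpoch_renewal] by blast
  show ?thesis
  proof (rule summable_comparison_test'[OF summable_mult[OF summable_cube_geometric[OF r(1,2)], of C], of 0])
    fix n
    have "real n ^ 3 * mass n \<le> real n ^ 3 * (C * r ^ n)" by (intro mult_left_mono r) simp
    then show "norm (real n ^ 3 * mass n) \<le> C * (real n ^ 3 * r ^ n)"
      using mass_nonneg[of n] by (simp add: abs_mult mult_ac)
  qed
qed

section \<open>Block averages, cycle rates and covariances\<close>

definition block_sum :: "(nat \<Rightarrow> (nat \<Rightarrow> nat) \<Rightarrow> real) \<Rightarrow> nat \<Rightarrow> real" where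
  "block_sum f k = (\<Sum>\<sigma>\<in>indec k. wt k \<sigma> * f k \<sigma>)"

lemma summable_block_sum:
  assumes "\<And>k \<sigma>. \<bar>f k \<sigma>\<bar> \<le> C * real k ^ i" and i: "0 < i" "i \<le> 3"
  shows "summable (block_sum f)"
proof (rule summable_comparison_test'[OF summable_mult[OF summable_mass, of C], of 0])
  fix k
  \<comment> \<open>The bound at k = 1, for an arbitrary argument, forces \<open>C\<close> to be
    nonnegative.\<close>
  have C: "0 \<le> C" using assms(1)[of 1 undefined] by simp
  have "real k ^ i \<le> real k ^ 3"
    using i by (cases "k = 0") (auto intro: power_increasing simp: zero_power)
  then have f: "\<bar>f k \<sigma>\<bar> \<le> C * real k ^ 3" for \<sigma>
    using assms(1)[of k \<sigma>] C by (meson mult_left_mono order_trans)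
  have "norm (block_sum f k) \<le> (\<Sum>\<sigma>\<in>indec k. \<bar>wt k \<sigma> * f k \<sigma>\<bar>)"
    unfolding block_sum_def real_norm_def by (rule sum_abs)
  also have "\<dots> \<le> (\<Sum>\<sigma>\<in>indec k. wt k \<sigma> * (C * real k ^ 3))"
    using f wt_pos[THEN less_imp_le] by (intro sum_mono) (simp add: abs_mult mult_left_mono)
  also have "\<dots> = C * (real k ^ 3 * mass k)"
    by (simp add: mass_def sum_distrib_left sum_distrib_right mult_ac)
  finally show "norm (block_sum f k) \<le> C * (real k ^ 3 * mass k)" .
qed

lemma block_sum_linear: "block_sum (\<lambda>k \<sigma>. \<Sum>i\<in>S. a i * f i k \<sigma>) = (\<lambda>k. \<Sum>i\<in>S. a i * block_sum (f i) k)"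
  unfolding block_sum_def sum_distrib_left
  by (intro ext, subst sum.swap) (simp add: mult_ac)

lemma suminf_block_sum_linear:
  assumes "\<And>i. i \<in> S \<Longrightarrow> summable (block_sum (f i))"
  shows "suminf (block_sum (\<lambda>k \<sigma>. \<Sum>i\<in>S. a i * f i k \<sigma>)) = (\<Sum>i\<in>S. a i * suminf (block_sum (f i)))"
  unfolding block_sum_linear using assms by (simp add: suminf_sum summable_mult suminf_mult)

lemma suminf_block_sum_pos:
  assumes "summable (block_sum f)" and f: "\<And>k \<sigma>. 0 \<le> f k \<sigma>" and "\<sigma> \<in> indec k" "0 < f k \<sigma>"
  shows "0 < suminf (block_sum f)"
proof (rule suminf_pos2[OF assms(1)])
  show "0 \<le> block_sum f k" for k
    unfolding block_sum_def using f wt_pos[THEN less_imp_le] by (intro sum_nonneg mult_nonneg_nonneg)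
  have "0 < wt k \<sigma> * f k \<sigma>" using assms(4) wt_pos by simp
  also have "\<dots> \<le> block_sum f k"
    unfolding block_sum_def using f wt_pos[THEN less_imp_le] assms(3) finite_indec
    by (intro member_le_sum) auto
  finally show "0 < block_sum f k" .
qed

definition block_mean :: real where
  "block_mean = suminf (block_sum (\<lambda>k \<sigma>. real k))"

text \<open>The constants m_i, as a renewal-reward quotient: average number of i-cycles in a block
  over average block length.\<close>

definition cycle_rate :: "nat \<Rightarrow> real" where
  "cycle_rate i = suminf (block_sum (\<lambda>k \<sigma>. real (cycle_count k i \<sigma>))) / block_mean"

definition cycle_dev :: "nat \<Rightarrow> nat \<Rightarrow> (nat \<Rightarrow> nat) \<Rightarrow> real" where
  "cycle_dev i n \<pi> = real (cycle_count n i \<pi>) - cycle_rate i * real n"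

text \<open>The matrix P. Each block is centred by its own random length, so the fluctuation of the
  number of blocks is already accounted for.\<close>

definition cycle_cov :: "nat \<Rightarrow> nat \<Rightarrow> real" where
  "cycle_cov i j = suminf (block_sum (\<lambda>k \<sigma>. cycle_dev i k \<sigma> * cycle_dev j k \<sigma>)) / block_mean"

lemma summable_block_size: "summable (block_sum (\<lambda>k \<sigma>. real k))"
  by (rule summable_block_sum[of _ 1 1]) auto

lemma summable_cycle_count: "summable (block_sum (\<lambda>k \<sigma>. real (cycle_count k i \<sigma>)))"
  by (rule summable_block_sum[of _ 1 1]) (auto simp: cycle_count_le)

lemma block_mean_pos: "0 < block_mean"
  unfolding block_mean_def by (rule suminf_block_sum_pos[OF summable_block_size _ rot_indec[of 1]]) auto

lemma cycle_rate_pos: "1 \<le> i \<Longrightarrow> 0 < cycle_rate i"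
  unfolding cycle_rate_def
  using cycle_count_rot[of i]
  by (intro divide_pos_pos block_mean_pos suminf_block_sum_pos[OF summable_cycle_count _ rot_indec[of i]]) auto

lemma cycle_dev_bound: "\<bar>cycle_dev i n \<pi>\<bar> \<le> (1 + \<bar>cycle_rate i\<bar>) * real n"
proof -
  have "\<bar>cycle_dev i n \<pi>\<bar> \<le> real (cycle_count n i \<pi>) + \<bar>cycle_rate i\<bar> * real n"
    unfolding cycle_dev_def by (rule order_trans[OF abs_triangle_ineq4]) (simp add: abs_mult)
  also have "\<dots> \<le> real n + \<bar>cycle_rate i\<bar> * real n" using cycle_count_le[of n i \<pi>] by simp
  finally show ?thesis by (simp add: algebra_simps)
qed

lemma cycle_dev_direct_sum:
  "\<sigma> \<in> perms k \<Longrightarrow> \<tau> \<in> perms m \<Longrightarrow>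
    cycle_dev i (k + m) (direct_sum k \<sigma> \<tau>) = cycle_dev i k \<sigma> + cycle_dev i m \<tau>"
  by (simp add: cycle_dev_def cycle_count_direct_sum algebra_simps)

lemma suminf_cycle_dev: "suminf (block_sum (cycle_dev i)) = 0"
proof -
  have "block_sum (cycle_dev i) =
      (\<lambda>k. block_sum (\<lambda>k \<sigma>. real (cycle_count k i \<sigma>)) k - cycle_rate i * block_sum (\<lambda>k \<sigma>. real k) k)"
    by (rule ext) (simp add: block_sum_def cycle_dev_def right_diff_distrib sum_subtractf sum_distrib_left mult_ac)
  then have "suminf (block_sum (cycle_dev i)) =
      suminf (block_sum (\<lambda>k \<sigma>. real (cycle_count k i \<sigma>))) - cycle_rate i * block_mean"
    using summable_cycle_count[of i] summable_block_size
    by (simp add: suminf_diff[symmetric] suminf_mult summable_mult block_mean_def)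
  then show ?thesis using block_mean_pos by (simp add: cycle_rate_def)
qed

lemma summable_cycle_dev: "summable (block_sum (cycle_dev i))"
  by (rule summable_block_sum[of _ "1 + \<bar>cycle_rate i\<bar>" 1]) (use cycle_dev_bound in auto)

lemma summable_cycle_dev2: "summable (block_sum (\<lambda>k \<sigma>. cycle_dev i k \<sigma> * cycle_dev j k \<sigma>))"
proof (rule summable_block_sum[of _ "(1 + \<bar>cycle_rate i\<bar>) * (1 + \<bar>cycle_rate j\<bar>)" 2])
  fix k \<sigma>
  have "\<bar>cycle_dev i k \<sigma>\<bar> * \<bar>cycle_dev j k \<sigma>\<bar> \<le> ((1 + \<bar>cycle_rate i\<bar>) * real k) * ((1 + \<bar>cycle_rate j\<bar>) * real k)"
    by (intro mult_mono cycle_dev_bound) auto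
  then show "\<bar>cycle_dev i k \<sigma> * cycle_dev j k \<sigma>\<bar> \<le> (1 + \<bar>cycle_rate i\<bar>) * (1 + \<bar>cycle_rate j\<bar>) * (real k)\<^sup>2"
    by (simp add: abs_mult power2_eq_square mult_ac)
qed auto

text \<open>The Cramer-Wold projection in direction \<theta>; it serves as the scalar mark
  \<open>y\<close> of the renewal locale.\<close>

definition dev_sum :: "nat set \<Rightarrow> (nat \<Rightarrow> real) \<Rightarrow> nat \<Rightarrow> (nat \<Rightarrow> nat) \<Rightarrow> real" where
  "dev_sum S \<theta> n \<pi> = (\<Sum>i\<in>S. \<theta> i * cycle_dev i n \<pi>)"

lemma suminf_dev_sum: "suminf (block_sum (dev_sum S \<theta>)) = 0"
proof -
  have "dev_sum S \<theta> = (\<lambda>k \<sigma>. \<Sum>i\<in>S. \<theta> i * cycle_dev i k \<sigma>)" by (simp add: dev_sum_def fun_eq_iff)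
  then show ?thesis
    using suminf_block_sum_linear[of S cycle_dev \<theta>] by (simp add: suminf_cycle_dev summable_cycle_dev)
qed

lemma suminf_dev_sum2:
  assumes "finite S"
  shows "suminf (block_sum (\<lambda>k \<sigma>. (dev_sum S \<theta> k \<sigma>)\<^sup>2)) = (\<Sum>i\<in>S. \<Sum>j\<in>S. \<theta> i * \<theta> j * cycle_cov i j) * block_mean"
proof -
  have "(\<lambda>k \<sigma>. (dev_sum S \<theta> k \<sigma>)\<^sup>2) = (\<lambda>k \<sigma>. \<Sum>a\<in>S \<times> S. (\<theta> (fst a) * \<theta> (snd a)) *
      (cycle_dev (fst a) k \<sigma> * cycle_dev (snd a) k \<sigma>))"
    by (simp add: dev_sum_def power2_eq_square sum_product sum.cartesian_product case_prod_unfold mult_ac)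
  then have "suminf (block_sum (\<lambda>k \<sigma>. (dev_sum S \<theta> k \<sigma>)\<^sup>2)) =
      (\<Sum>a\<in>S \<times> S. (\<theta> (fst a) * \<theta> (snd a)) *
        suminf (block_sum (\<lambda>k \<sigma>. cycle_dev (fst a) k \<sigma> * cycle_dev (snd a) k \<sigma>)))"
    using suminf_block_sum_linear[of "S \<times> S" "\<lambda>a k \<sigma>. cycle_dev (fst a) k \<sigma> * cycle_dev (snd a) k \<sigma>"
        "\<lambda>a. \<theta> (fst a) * \<theta> (snd a)"] by (simp add: summable_cycle_dev2)
  also have "\<dots> = (\<Sum>a\<in>S \<times> S. (\<theta> (fst a) * \<theta> (snd a)) * cycle_cov (fst a) (snd a)) * block_mean"
    using block_mean_pos by (simp add: cycle_cov_def sum_distrib_right)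
  finally show ?thesis by (simp add: sum.cartesian_product case_prod_unfold)
qed

text \<open>Up to the factor \<open>block_mean\<close>, the form is a weighted sum of squares of
  \<open>dev_sum\<close>. This provides both \<open>0 \<le> V\<close> for the renewal locale and a
  square root of the covariance.\<close>

lemma cycle_cov_psd:
  assumes "finite S"
  shows "0 \<le> (\<Sum>i\<in>S. \<Sum>j\<in>S. \<theta> i * \<theta> j * cycle_cov i j)"
proof -
  have eq: "block_sum (\<lambda>k \<sigma>. (dev_sum S \<theta> k \<sigma>)\<^sup>2) = (\<lambda>k. \<Sum>a\<in>S \<times> S. (\<theta> (fst a) * \<theta> (snd a)) *
      block_sum (\<lambda>k \<sigma>. cycle_dev (fst a) k \<sigma> * cycle_dev (snd a) k \<sigma>) k)"
    unfolding block_sum_linear[symmetric]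
    by (simp add: dev_sum_def power2_eq_square sum_product sum.cartesian_product case_prod_unfold mult_ac)
  have "summable (block_sum (\<lambda>k \<sigma>. (dev_sum S \<theta> k \<sigma>)\<^sup>2))"
    unfolding eq by (intro summable_sum summable_mult summable_cycle_dev2)
  then have "0 \<le> suminf (block_sum (\<lambda>k \<sigma>. (dev_sum S \<theta> k \<sigma>)\<^sup>2))"
    by (rule suminf_nonneg)
       (unfold block_sum_def, intro sum_nonneg mult_nonneg_nonneg wt_pos[THEN less_imp_le] zero_le_power2)
  then show ?thesis
    unfolding suminf_dev_sum2[OF assms] using block_mean_pos by (simp add: zero_le_mult_iff)
qed

text \<open>The Mallows characteristic function is \<open>v\<close> at s = 1 / sqrt n divided by the
  total mass \<open>qpoch q n\<close>. Both limits contain the factor \<open>qlim q\<close>, which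
  cancels.\<close>

lemma char_fun_limit:
  assumes S: "finite S"
  shows "(\<lambda>n. \<Sum>\<pi>\<in>perms n. of_real (mallows_prob n q \<pi>) *
      cis (\<Sum>i\<in>S. \<theta> i * ((real (cycle_count n i \<pi>) - cycle_rate i * real n) / sqrt (real n))))
    \<longlonglongrightarrow> of_real (exp (- (\<Sum>i\<in>S. \<Sum>j\<in>S. \<theta> i * \<theta> j * cycle_cov i j) / 2))"
proof -
  define V where "V = (\<Sum>i\<in>S. \<Sum>j\<in>S. \<theta> i * \<theta> j * cycle_cov i j)"
  define L where "L = (\<Sum>i\<in>S. \<bar>\<theta> i\<bar> * (1 + \<bar>cycle_rate i\<bar>))"
  define v where "v s n = (\<Sum>\<pi>\<in>perms n. of_real (wt n \<pi>) * cis (s * dev_sum S \<theta> n \<pi>))" for s n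
  have size: "(\<Sum>k. real k * mass k) = block_mean"
    unfolding block_mean_def block_sum_def mass_def by (simp add: sum_distrib_left mult_ac)
  interpret marked_renewal indec wt "dev_sum S \<theta>" mass "qpoch q" v L V "qlim q"
  proof
    show "\<bar>dev_sum S \<theta> k \<sigma>\<bar> \<le> L * real k" for k \<sigma>
    proof -
      have "\<bar>dev_sum S \<theta> k \<sigma>\<bar> \<le> (\<Sum>i\<in>S. \<bar>\<theta> i * cycle_dev i k \<sigma>\<bar>)"
        unfolding dev_sum_def by (rule sum_abs)
      also have "\<dots> \<le> (\<Sum>i\<in>S. \<bar>\<theta> i\<bar> * ((1 + \<bar>cycle_rate i\<bar>) * real k))"
        unfolding abs_mult by (intro sum_mono mult_left_mono cycle_dev_bound) auto
      finally show ?thesis by (simp add: L_def sum_distrib_right mult.assoc)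
    qed
    show "v s n = (if n = 0 then 1 else 0) +
        (\<Sum>k\<le>n. (\<Sum>\<sigma>\<in>indec k. of_real (wt k \<sigma>) * cis (s * dev_sum S \<theta> k \<sigma>)) * v s (n - k))" for s n
      unfolding v_def
    proof (rule wt_renewal)
      have "cycle_count 0 i id = 0" for i by (simp add: cycle_count_def)
      then show "cis (s * dev_sum S \<theta> 0 id) = 1" by (simp add: dev_sum_def cycle_dev_def)
    next
      fix k m \<sigma> \<tau> assume "\<sigma> \<in> perms k" "\<tau> \<in> perms m"
      then have "dev_sum S \<theta> (k + m) (direct_sum k \<sigma> \<tau>) = dev_sum S \<theta> k \<sigma> + dev_sum S \<theta> m \<tau>"
        by (simp add: dev_sum_def cycle_dev_direct_sum distrib_left sum.distrib)
      then show "cis (s * dev_sum S \<theta> (k + m) (direct_sum k \<sigma> \<tau>)) =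
          cis (s * dev_sum S \<theta> k \<sigma>) * cis (s * dev_sum S \<theta> m \<tau>)"
        by (simp add: cis_mult distrib_left)
    qed
    show "\<bar>qpoch q n\<bar> \<le> 1" for n
      using qpoch_pos[OF q, of n] qpoch_le_1[OF q, of n] by simp
    show "0 \<le> V" unfolding V_def by (rule cycle_cov_psd[OF S])
    show "0 \<le> L" unfolding L_def by (intro sum_nonneg) auto
    show "(\<Sum>k. \<Sum>\<sigma>\<in>indec k. wt k \<sigma> * dev_sum S \<theta> k \<sigma>) = 0"
      using suminf_dev_sum[of S \<theta>] by (simp add: block_sum_def[abs_def])
    show "(\<Sum>k. \<Sum>\<sigma>\<in>indec k. wt k \<sigma> * (dev_sum S \<theta> k \<sigma>)\<^sup>2) = V * (\<Sum>k. real k * mass k)"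
      using suminf_dev_sum2[OF S, of \<theta>] unfolding size V_def by (simp add: block_sum_def[abs_def])
    show "qpoch q n = (if n = 0 then 1 else 0) + (\<Sum>k\<le>n. mass k * qpoch q (n - k))" for n
      by (rule qpoch_renewal)
    show "0 \<le> qlim q" "qlim q \<le> 1" using qlim_pos[OF q] qlim_le_1[OF q] by auto
    show "0 \<le> wt k \<sigma>" for k \<sigma> by (rule less_imp_le[OF wt_pos])
  qed (simp_all add: indec_0 mass_def summable_mass[unfolded mass_def] summable_qpoch_diff[OF q])
  have "(\<lambda>n. v (1 / sqrt (real n)) n / of_real (qpoch q n)) \<longlonglongrightarrow>
      of_real (qlim q * exp (- V / 2)) / of_real (qlim q)"
    using qlim_pos[OF q] by (intro tendsto_divide v_limit tendsto_of_real qpoch_LIMSEQ[OF q]) auto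
  moreover have "v (1 / sqrt (real n)) n / of_real (qpoch q n) =
      (\<Sum>\<pi>\<in>perms n. of_real (mallows_prob n q \<pi>) *
      cis (\<Sum>i\<in>S. \<theta> i * ((real (cycle_count n i \<pi>) - cycle_rate i * real n) / sqrt (real n))))" for n
    by (simp add: v_def mallows_prob_eq dev_sum_def cycle_dev_def sum_divide_distrib)
  ultimately show ?thesis using qlim_pos[OF q] by (simp add: V_def)
qed

lemma mallows_prob_nonneg: "0 \<le> mallows_prob n q \<pi>"
  using wt_pos[of n \<pi>] qpoch_pos[OF q, of n] by (simp add: mallows_prob_eq)

lemma sum_mallows_prob: "(\<Sum>\<pi>\<in>perms n. mallows_prob n q \<pi>) = 1"
  using qpoch_pos[OF q, of n] by (simp add: mallows_prob_eq sum_divide_distrib[symmetric] sum_wt)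

lemma cycle_count_clt:
  "conv_dist_normal l (\<lambda>n f. mallows_expect n q (\<lambda>\<pi>. f (cycle_vec l cycle_rate n \<pi>))) cycle_cov"
proof -
  let ?S = "{1..l}"
  have "cycle_cov i j = cycle_cov j i" for i j by (simp add: cycle_cov_def mult.commute)
  then obtain A where A: "\<forall>i\<in>?S. \<forall>j\<in>?S. cycle_cov i j = (\<Sum>k\<in>?S. A i k * A j k)"
    using psd_factorization[of ?S cycle_cov] cycle_cov_psd[of ?S] by auto
  \<comment> \<open>The Mallows law as a measure, which turns the finite sums of
    \<open>mallows_expect\<close> into integrals.\<close>
  define \<mu> where "\<mu> n = point_measure (perms n) (\<lambda>\<pi>. ennreal (mallows_prob n q \<pi>))" for n
  define X where "X = cycle_vec l cycle_rate"
  define M where "M n = distr (\<mu> n) borel (X n)" for n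
  define M' where "M' = distr (std_gauss_vec l) borel (lin_map l A)"
  have X: "X n \<in> borel_measurable (\<mu> n)" for n
    by (simp add: \<mu>_def measurable_point_measure_eq1)
  have prob: "prob_space (\<mu> n)" for n
    unfolding \<mu>_def by (rule prob_space_point_measure) (simp_all add: finite_perms mallows_prob_nonneg sum_mallows_prob)
  have int: "(\<integral>\<pi>. g \<pi> \<partial>\<mu> n) = (\<Sum>\<pi>\<in>perms n. mallows_prob n q \<pi> *\<^sub>R g \<pi>)"
    for g :: "(nat \<Rightarrow> nat) \<Rightarrow> 'b::{banach, second_countable_topology}" and n
    unfolding \<mu>_def by (rule lebesgue_integral_point_measure_finite) (simp_all add: finite_perms mallows_prob_nonneg)
  have Mn: "rvec_measure (M n) ?S" for n
  proof -
    interpret \<mu>: prob_space "\<mu> n" by (rule prob)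
    interpret M: prob_space "M n" unfolding M_def by (rule \<mu>.prob_space_distr[OF X])
    show ?thesis
    proof
      show "AE x in M n. \<forall>i. i \<notin> ?S \<longrightarrow> x i = 0"
        unfolding M_def by (subst AE_distr_iff[OF X]) (auto simp: X_def cycle_vec_def)
    qed (auto simp: M_def)
  qed
  have M': "rvec_measure M' ?S" unfolding M'_def by (rule rvec_measure_gauss)
  have chf: "(\<lambda>n. rvec_measure.chf (M n) ?S \<theta>) \<longlonglongrightarrow> rvec_measure.chf M' ?S \<theta>" for \<theta>
  proof -
    \<comment> \<open>Since A A^T is the covariance on these indices, the squared norm of A^T
      \<theta> is the quadratic form in the exponent of \<open>char_fun_limit\<close>.\<close>
    have "(\<Sum>k\<in>?S. (\<Sum>i\<in>?S. \<theta> i * A i k)\<^sup>2) = (\<Sum>i\<in>?S. \<Sum>j\<in>?S. \<theta> i * \<theta> j * cycle_cov i j)"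
    proof -
      have "(\<Sum>k\<in>?S. (\<Sum>i\<in>?S. \<theta> i * A i k)\<^sup>2) =
          (\<Sum>k\<in>?S. \<Sum>i\<in>?S. \<Sum>j\<in>?S. \<theta> i * \<theta> j * (A i k * A j k))"
        by (simp add: power2_eq_square sum_product mult_ac)
      also have "\<dots> = (\<Sum>i\<in>?S. \<Sum>j\<in>?S. \<Sum>k\<in>?S. \<theta> i * \<theta> j * (A i k * A j k))"
        by (rule trans[OF sum.swap], rule sum.cong[OF refl], rule sum.swap)
      also have "\<dots> = (\<Sum>i\<in>?S. \<Sum>j\<in>?S. \<theta> i * \<theta> j * cycle_cov i j)"
        using A by (intro sum.cong refl) (simp add: sum_distrib_left)
      finally show ?thesis .
    qed
    then have "rvec_measure.chf M' ?S \<theta> = of_real (exp (- (\<Sum>i\<in>?S. \<Sum>j\<in>?S. \<theta> i * \<theta> j * cycle_cov i j) / 2))"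
      unfolding M'_def chf_gauss by simp
    moreover have "rvec_measure.chf (M n) ?S \<theta> = (\<Sum>\<pi>\<in>perms n. of_real (mallows_prob n q \<pi>) *
      cis (\<Sum>i\<in>?S. \<theta> i * ((real (cycle_count n i \<pi>) - cycle_rate i * real n) / sqrt (real n))))" for n
    proof -
      have "(\<lambda>x. cis (\<Sum>i\<in>?S. \<theta> i * x i)) \<in> borel_measurable borel"
        using borel_measurable_trig_polys[OF trig_polys.monomial[of 1 \<theta> ?S]] by simp
      then have "rvec_measure.chf (M n) ?S \<theta> = (\<integral>\<pi>. cis (\<Sum>i\<in>?S. \<theta> i * X n \<pi> i) \<partial>\<mu> n)"
        unfolding rvec_measure.chf_def[OF Mn] unfolding M_def by (rule integral_distr[OF X])
      also have "\<dots> = (\<Sum>\<pi>\<in>perms n. mallows_prob n q \<pi> *\<^sub>R cis (\<Sum>i\<in>?S. \<theta> i * X n \<pi> i))"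
        by (rule int)
      finally show ?thesis
        by (simp add: X_def cycle_vec_def scaleR_conv_of_real)
    qed
    ultimately show ?thesis using char_fun_limit[of ?S \<theta>] by simp
  qed
  show ?thesis
    unfolding conv_dist_normal_def
  proof (intro exI[of _ A] conjI A allI impI)
    fix f :: "(nat \<Rightarrow> real) \<Rightarrow> real" assume f: "continuous_on UNIV f" "bounded (range f)"
    have fm: "f \<in> borel_measurable borel" using f(1) by (rule borel_measurable_continuous_onI)
    have "(\<integral>x. f x \<partial>M n) = mallows_expect n q (\<lambda>\<pi>. f (cycle_vec l cycle_rate n \<pi>))" for n
      unfolding M_def integral_distr[OF X fm] int mallows_expect_def by (simp add: X_def)
    moreover have "(\<integral>x. f x \<partial>M') = (\<integral>g. f (lin_map l A g) \<partial>std_gauss_vec l)"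
      unfolding M'_def by (rule integral_distr[OF borel_measurable_lin_map fm])
    ultimately show "(\<lambda>n. mallows_expect n q (\<lambda>\<pi>. f (cycle_vec l cycle_rate n \<pi>)))
        \<longlonglongrightarrow> (\<integral>g. f (lin_map l A g) \<partial>std_gauss_vec l)"
      using levy_continuity_finite_dim[OF Mn M' chf f] by simp
  qed
qed

end

theorem theorem1p1:
  fixes q :: real
  assumes "0 < q" and "q < 1"
  shows "\<exists>(m :: nat \<Rightarrow> real) (P :: nat \<Rightarrow> nat \<Rightarrow> real).
           (\<forall>i\<ge>1. m i > 0) \<and>
           (\<forall>l\<ge>1. conv_dist_normal l
                      (\<lambda>n f. mallows_expect n q (\<lambda>\<pi>. f (cycle_vec l m n \<pi>))) P)"
  using cycle_rate_pos[OF assms] cycle_count_clt[OF assms] by blast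

end
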